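(* Let $n\in\mathbb{N}_0=\{0,1,2,\dots\}$ and let $\nu>n-1$ be real. The following statements hold. (a) $r^c(g_{\nu,n})$ satisfies the inequalities $$\frac23\sqrt{\frac{(\nu-n+2)(\nu-n+1)}{\nu+2}}<r^c(g_{\nu,n})<2\sqrt{\frac{1}{\frac{9(\nu+2)}{(\nu-n+2)(\nu-n+1)}-\frac{25(\nu+4)(\nu+3)}{9(\nu-n+4)(\nu-n+3)(\nu+2)}}}.$$ (b) $r^c(h_{\nu,n})$ satisfies the inequalities $$\frac{(\nu-n+2)(\nu-n+1)}{\nu+2}<r^c(h_{\nu,n})<\frac{1}{\frac{\nu+2}{(\nu-n+2)(\nu-n+1)}-\frac{9(\nu+4)(\nu+3)}{16(\nu-n+4)(\nu-n+3)(\nu+2)}}.$$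
   Context: $J_\nu(z)=\sum_{m\ge 0}\frac{(-1)^m}{m!\,\Gamma(m+\nu+1)}\left(\frac z2\right)^{2m+\nu}$ is the Bessel function of the first kind of order $\nu$, and $J_\nu^{(n)}$ is its $n$th derivative. For $\nu>n-1$ define the entire functions $$g_{\nu,n}(z)=2^\nu\Gamma(\nu-n+1)z^{1+n-\nu}J_\nu^{(n)}(z)=\sum_{m\ge0}\frac{(-1)^m\Gamma(2m+\nu+1)\Gamma(\nu-n+1)}{m!\,4^m\,\Gamma(2m-n+\nu+1)\Gamma(m+\nu+1)}z^{2m+1},$$ $$h_{\nu,n}(z)=2^\nu\Gamma(\nu-n+1)z^{1+\frac{n-\nu}2}J_\nu^{(n)}(\sqrt z)=\sum_{m\ge0}\frac{(-1)^m\Gamma(2m+\nu+1)\Gamma(\nu-n+1)}{m!\,4^m\,\Gamma(2m-n+\nu+1)\Gamma(m+\nu+1)}z^{m+1}.$$ For an entire function $f$ with $f(0)=0$, $f'(0)=1$, the radius of convexity (of order $0$) is $$r^c(f)=\sup\left\{r>0:\ \mathrm{Re}\left(1+\frac{zf''(z)}{f'(z)}\right)>0\ \text{for all } z\in\mathbb{D}_r\right\},\qquad \mathbb{D}_r=\{z\in\mathbb{C}:|z|<r\}.$$ *)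

theory Defs
  imports "HOL-Complex_Analysis.Complex_Analysis"
begin

text \<open>Principal branch. Only its values on the slit plane are used below; at \<open>z = 0\<close> the convention
  \<open>0 powr s = 0\<close> need not give the limiting value.\<close>

definition bessel_J :: "real \<Rightarrow> complex \<Rightarrow> complex" where
  "bessel_J \<nu> z =
     (\<Sum>m. complex_of_real ((-1) ^ m / (fact m * Gamma (real m + \<nu> + 1)))
          * (z / 2) powr complex_of_real (2 * real m + \<nu>))"

text \<open>The formulas for \<open>g\<close> and \<open>h\<close> involve multivalued powers. Their principal branches are used on
  the slit plane, where they are holomorphic, and the resulting function is continued to the
  whole plane. Existence and uniqueness of the continuation, together with the power series, are
  \<open>bessel_g_properties\<close> and \<open>bessel_h_properties\<close> below.\<close>

definition entire_extension :: "(complex \<Rightarrow> complex) \<Rightarrow> complex \<Rightarrow> complex" where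
  "entire_extension F =
     (THE f. f holomorphic_on UNIV \<and> (\<forall>z. z \<notin> \<real>\<^sub>\<le>\<^sub>0 \<longrightarrow> f z = F z))"

definition bessel_g :: "real \<Rightarrow> nat \<Rightarrow> complex \<Rightarrow> complex" where
  "bessel_g \<nu> n = entire_extension (\<lambda>z.
     complex_of_real (2 powr \<nu> * Gamma (\<nu> - real n + 1))
       * z powr complex_of_real (1 + real n - \<nu>) * (deriv ^^ n) (bessel_J \<nu>) z)"

definition bessel_h :: "real \<Rightarrow> nat \<Rightarrow> complex \<Rightarrow> complex" where
  "bessel_h \<nu> n = entire_extension (\<lambda>z.
     complex_of_real (2 powr \<nu> * Gamma (\<nu> - real n + 1))
       * z powr complex_of_real (1 + (real n - \<nu>) / 2) * (deriv ^^ n) (bessel_J \<nu>) (csqrt z))"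

text \<open>The supremum is taken in the extended reals, so that it is meaningful also when the set of
  admissible radii is unbounded. Since \<open>x / 0 = 0\<close> in HOL, the condition \<open>deriv f z \<noteq> 0\<close>,
  implicit in the quotient, is made explicit.\<close>

definition radius_of_convexity :: "(complex \<Rightarrow> complex) \<Rightarrow> ereal" where
  "radius_of_convexity f =
     Sup (ereal ` {r. r > 0 \<and> (\<forall>z \<in> ball 0 r.
        deriv f z \<noteq> 0 \<and> Re (1 + z * (deriv ^^ 2) f z / deriv f z) > 0)})"


subsection \<open>Well-definedness and power series\<close>

definition bessel_coeff :: "real \<Rightarrow> nat \<Rightarrow> nat \<Rightarrow> real" where
  "bessel_coeff \<nu> n m =
     (-1) ^ m * Gamma (2 * real m + \<nu> + 1) * Gamma (\<nu> - real n + 1)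
       / (fact m * 4 ^ m * Gamma (2 * real m - real n + \<nu> + 1) * Gamma (real m + \<nu> + 1))"

lemma entire_extension_eqI:
  assumes "f holomorphic_on UNIV" "\<And>z. z \<notin> \<real>\<^sub>\<le>\<^sub>0 \<Longrightarrow> f z = F z"
  shows "entire_extension F = f"
  unfolding entire_extension_def
proof (rule the_equality)
  show "f holomorphic_on UNIV \<and> (\<forall>z. z \<notin> \<real>\<^sub>\<le>\<^sub>0 \<longrightarrow> f z = F z)"
    using assms by blast
next
  fix g assume g: "g holomorphic_on UNIV \<and> (\<forall>z. z \<notin> \<real>\<^sub>\<le>\<^sub>0 \<longrightarrow> g z = F z)"
  show "g = f"
  proof
    fix z
    have op: "open (- \<real>\<^sub>\<le>\<^sub>0 :: complex set)"
      by (simp add: open_Compl)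
    have ne: "(- \<real>\<^sub>\<le>\<^sub>0 :: complex set) \<noteq> {}"
    proof -
      have "(1::complex) \<in> - \<real>\<^sub>\<le>\<^sub>0" by simp
      then show ?thesis by blast
    qed
    show "g z = f z"
      by (rule analytic_continuation_open[OF op _ ne _ _ _ _ _, of UNIV])
         (use g assms in auto)
  qed
qed

lemma deriv_coeffs_summable:
  fixes b :: "nat \<Rightarrow> complex" and c :: complex
  assumes "\<And>w. summable (\<lambda>m. b m * w ^ m)"
  shows "summable (\<lambda>m. (2 * of_nat m + c) * b m * w ^ m)"
    and "((\<lambda>w. \<Sum>m. b m * w ^ m) has_field_derivative (\<Sum>m. diffs b m * w ^ m)) (at w)"
    and "(\<Sum>m. (2 * of_nat m + c) * b m * w ^ m)
           = 2 * w * (\<Sum>m. diffs b m * w ^ m) + c * (\<Sum>m. b m * w ^ m)"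
proof -
  have "(\<lambda>m. of_nat m * b m * w ^ (m - Suc 0)) sums (\<Sum>m. diffs b m * w ^ m)"
    by (rule diffs_equiv, rule termdiff_converges_all) (rule assms)
  then have "(\<lambda>m. 2 * w * (of_nat m * b m * w ^ (m - Suc 0)))
      sums (2 * w * (\<Sum>m. diffs b m * w ^ m))"
    by (rule sums_mult)
  moreover have "2 * w * (of_nat m * b m * w ^ (m - Suc 0)) = 2 * of_nat m * b m * w ^ m" for m
    by (cases m) auto
  ultimately have 1: "(\<lambda>m. 2 * of_nat m * b m * w ^ m) sums (2 * w * (\<Sum>m. diffs b m * w ^ m))"
    by simp
  have 2: "(\<lambda>m. c * (b m * w ^ m)) sums (c * (\<Sum>m. b m * w ^ m))"
    by (intro sums_mult summable_sums assms)
  have 3: "(\<lambda>m. (2 * of_nat m + c) * b m * w ^ m)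
     sums (2 * w * (\<Sum>m. diffs b m * w ^ m) + c * (\<Sum>m. b m * w ^ m))"
    using sums_add[OF 1 2] by (simp add: algebra_simps)
  show "summable (\<lambda>m. (2 * of_nat m + c) * b m * w ^ m)"
    using 3 by (rule sums_summable)
  show "(\<Sum>m. (2 * of_nat m + c) * b m * w ^ m)
           = 2 * w * (\<Sum>m. diffs b m * w ^ m) + c * (\<Sum>m. b m * w ^ m)"
    using 3 by (rule sums_unique[symmetric])
  show "((\<lambda>w. \<Sum>m. b m * w ^ m) has_field_derivative (\<Sum>m. diffs b m * w ^ m)) (at w)"
    by (rule termdiffs_strong_converges_everywhere) (rule assms)
qed

definition bessel_aux :: "real \<Rightarrow> nat \<Rightarrow> nat \<Rightarrow> complex" where
  "bessel_aux \<nu> n m =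
     (\<Prod>i<n. 2 * of_nat m + of_real (\<nu> - real i))
       * of_real ((-1) ^ m / (fact m * Gamma (real m + \<nu> + 1) * 4 ^ m * 2 powr \<nu>))"

lemma bessel_aux_Suc:
  "bessel_aux \<nu> (Suc n) m = (2 * of_nat m + of_real (\<nu> - real n)) * bessel_aux \<nu> n m"
  by (simp add: bessel_aux_def mult_ac)

lemma bessel_aux_summable:
  assumes \<nu>: "\<nu> > -1"
  shows "summable (\<lambda>m. bessel_aux \<nu> n m * w ^ m)"
proof (induction n arbitrary: w)
  case 0
  have pos: "Gamma (real m + \<nu> + 1) > 0" for m
    by (rule Gamma_real_pos) (use \<nu> in linarith)
  obtain N :: nat where N: "real N > norm w + 1" "N > 0"
    by (metis gr0I of_nat_0 reals_Archimedean2 norm_ge_zero add_nonneg_pos less_asym zero_less_one)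
  show ?case
  proof (rule summable_ratio_test[where c = "1/2" and N = N])
    fix m assume m: "m \<ge> N"
    define t where "t = real m + \<nu> + 1"
    have t: "t > 0" "t \<ge> real m" if "\<nu> \<ge> -1" using m N \<nu> by (auto simp: t_def)
    have G: "Gamma (real (Suc m) + \<nu> + 1) = t * Gamma t"
      using Gamma_plus1[of t] t \<nu> by (auto simp: t_def add_ac nonpos_Ints_def)
    have tG: "Gamma t > 0" using pos[of m] by (simp add: t_def)
    have "norm (bessel_aux \<nu> 0 (Suc m) * w ^ Suc m)
        = norm w / ((real m + 1) * t * 4) * norm (bessel_aux \<nu> 0 m * w ^ m)"
      using tG t \<nu> unfolding bessel_aux_def norm_mult norm_of_real G
      by (simp add: norm_mult norm_power abs_mult t_def[symmetric] divide_simps)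
    also have "norm w / ((real m + 1) * t * 4) \<le> 1/2"
    proof -
      have "norm w \<le> real m" using m N by linarith
      also have "real m \<le> t" using t \<nu> by simp
      also have "t \<le> (real m + 1) * t" using t \<nu> by (simp add: algebra_simps)
      finally have "norm w \<le> (real m + 1) * t" .
      moreover have "0 < (real m + 1) * t" using t \<nu> by simp
      ultimately show ?thesis by (subst pos_divide_le_eq) linarith+
    qed
    then have "norm w / ((real m + 1) * t * 4) * norm (bessel_aux \<nu> 0 m * w ^ m)
        \<le> 1/2 * norm (bessel_aux \<nu> 0 m * w ^ m)"
      by (intro mult_right_mono) auto
    finally show "norm (bessel_aux \<nu> 0 (Suc m) * w ^ Suc m)
        \<le> 1/2 * norm (bessel_aux \<nu> 0 m * w ^ m)" .
  qed simp
next
  case (Suc n)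
  show ?case
    unfolding bessel_aux_Suc by (rule deriv_coeffs_summable) (rule Suc.IH)
qed

lemma deriv_bessel_J:
  assumes \<nu>: "\<nu> > -1" and "z \<notin> \<real>\<^sub>\<le>\<^sub>0"
  shows "(deriv ^^ n) (bessel_J \<nu>) z
           = z powr of_real (\<nu> - real n) * (\<Sum>m. bessel_aux \<nu> n m * (z\<^sup>2) ^ m)"
  using assms(2)
proof (induction n arbitrary: z)
  case 0
  then have z: "z \<noteq> 0" by auto
  have Lz: "Ln (z / 2) = Ln z - of_real (ln 2)"
    using Ln_divide_of_real[of 2 z] z by simp
  have "complex_of_real ((-1) ^ m / (fact m * Gamma (real m + \<nu> + 1)))
          * (z / 2) powr complex_of_real (2 * real m + \<nu>)
      = z powr of_real \<nu> * (bessel_aux \<nu> 0 m * (z\<^sup>2) ^ m)" for m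
  proof -
    have "(z / 2) powr complex_of_real (2 * real m + \<nu>)
        = (z / 2) powr of_nat (2 * m) * (z / 2) powr of_real \<nu>"
      by (simp add: powr_add)
    also have "(z / 2) powr of_nat (2 * m) = (z\<^sup>2) ^ m / 4 ^ m"
      using z by (subst powr_nat') (auto simp: power_mult power_divide)
    also have "(z / 2) powr of_real \<nu> = z powr of_real \<nu> / of_real (2 powr \<nu>)"
      using z by (simp add: powr_def Lz right_diff_distrib exp_diff exp_of_real[symmetric])
    finally show ?thesis by (simp add: bessel_aux_def mult_ac)
  qed
  then have "bessel_J \<nu> z = (\<Sum>m. z powr of_real \<nu> * (bessel_aux \<nu> 0 m * (z\<^sup>2) ^ m))"
    unfolding bessel_J_def by simp
  then show ?case
    using suminf_mult[OF bessel_aux_summable[OF \<nu>, of 0 "z\<^sup>2"]] by simp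
next
  case (Suc n)
  then have z: "z \<noteq> 0" by auto
  define P where "P w = (\<Sum>m. bessel_aux \<nu> n m * w ^ m)" for w
  define D where "D = (\<Sum>m. diffs (bessel_aux \<nu> n) m * (z\<^sup>2) ^ m)"
  note S = deriv_coeffs_summable[OF bessel_aux_summable[OF \<nu>, of n]]
  have dP: "(P has_field_derivative D) (at (z\<^sup>2))"
    unfolding P_def D_def by (rule S(2))
  have dP2: "((\<lambda>z. P (z\<^sup>2)) has_field_derivative (D * (2 * z))) (at z)"
    by (rule DERIV_chain2[where f = P and g = "\<lambda>z. z\<^sup>2", OF dP]) (auto intro!: derivative_eq_intros)
  have "((\<lambda>z. z powr of_real (\<nu> - real n) * P (z\<^sup>2)) has_field_derivative
       (of_real (\<nu> - real n) * z powr (of_real (\<nu> - real n) - 1) * P (z\<^sup>2)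
          + D * (2 * z) * z powr of_real (\<nu> - real n))) (at z)"
    by (rule DERIV_mult[OF has_field_derivative_powr[OF Suc.prems] dP2])
  then have "((deriv ^^ n) (bessel_J \<nu>) has_field_derivative
       (of_real (\<nu> - real n) * z powr (of_real (\<nu> - real n) - 1) * P (z\<^sup>2)
          + D * (2 * z) * z powr of_real (\<nu> - real n))) (at z)"
    by (rule has_field_derivative_transform_within_open[where S = "- \<real>\<^sub>\<le>\<^sub>0"])
       (use Suc in \<open>auto simp: P_def open_Compl\<close>)
  then have "(deriv ^^ Suc n) (bessel_J \<nu>) z
      = of_real (\<nu> - real n) * z powr (of_real (\<nu> - real n) - 1) * P (z\<^sup>2)
          + D * (2 * z) * z powr of_real (\<nu> - real n)"
    by (simp add: DERIV_imp_deriv)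
  also have "z powr of_real (\<nu> - real n) = z powr (of_real (\<nu> - real n) - 1) * z"
    using z by (simp add: powr_diff)
  also have "of_real (\<nu> - real n) * z powr (of_real (\<nu> - real n) - 1) * P (z\<^sup>2)
          + D * (2 * z) * (z powr (of_real (\<nu> - real n) - 1) * z)
      = z powr (of_real (\<nu> - real n) - 1) * (2 * z\<^sup>2 * D + of_real (\<nu> - real n) * P (z\<^sup>2))"
    by (simp add: algebra_simps power2_eq_square)
  also have "2 * z\<^sup>2 * D + of_real (\<nu> - real n) * P (z\<^sup>2)
      = (\<Sum>m. bessel_aux \<nu> (Suc n) m * (z\<^sup>2) ^ m)"
    unfolding P_def D_def bessel_aux_Suc by (rule S(3)[symmetric])
  also have "of_real (\<nu> - real n) - 1 = complex_of_real (\<nu> - real (Suc n))"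
    by simp
  finally show ?case .
qed

lemma prod_eq_Gamma_quotient:
  fixes x :: real
  assumes "x > real n - 1"
  shows "(\<Prod>i<n. x - real i) = Gamma (x + 1) / Gamma (x - real n + 1)"
  using assms
proof (induction n)
  case 0
  then have "Gamma (x + 1) > 0" by (intro Gamma_real_pos) simp
  then show ?case by simp
next
  case (Suc n)
  then have p: "x - real n > 0" by simp
  then have "Gamma (x - real n + 1) = (x - real n) * Gamma (x - real n)"
    by (intro Gamma_plus1) (auto simp: nonpos_Ints_def)
  moreover have "Gamma (x - real n) > 0" using p by (rule Gamma_real_pos)
  moreover have "x - real (Suc n) + 1 = x - real n" by simp
  ultimately show ?case
    using Suc.IH p by simp
qed

lemma bessel_aux_eq_coeff:
  assumes "\<nu> > real n - 1"
  shows "of_real (2 powr \<nu> * Gamma (\<nu> - real n + 1)) * bessel_aux \<nu> n m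
           = of_real (bessel_coeff \<nu> n m)"
proof -
  have "(\<Prod>i<n. 2 * of_nat m + of_real (\<nu> - real i))
      = complex_of_real (\<Prod>i<n. (2 * real m + \<nu>) - real i)"
    by (simp add: algebra_simps)
  also have "(\<Prod>i<n. (2 * real m + \<nu>) - real i)
      = Gamma (2 * real m + \<nu> + 1) / Gamma (2 * real m + \<nu> - real n + 1)"
    by (rule prod_eq_Gamma_quotient) (use assms in simp)
  finally show ?thesis
    by (simp add: bessel_aux_def bessel_coeff_def algebra_simps)
qed

lemma bessel_series:
  assumes "\<nu> > real n - 1"
  defines "P \<equiv> \<lambda>w. \<Sum>m. complex_of_real (bessel_coeff \<nu> n m) * w ^ m"
  shows bessel_coeff_summable: "summable (\<lambda>m. complex_of_real (bessel_coeff \<nu> n m) * w ^ m)"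
    and bessel_series_holomorphic: "P holomorphic_on UNIV"
    and bessel_series_eq:
      "P w = of_real (2 powr \<nu> * Gamma (\<nu> - real n + 1)) * (\<Sum>m. bessel_aux \<nu> n m * w ^ m)"
proof -
  have \<nu>: "\<nu> > -1" using assms(1) by linarith
  note S = bessel_aux_summable[OF \<nu>, of n]
  have eq: "of_real (2 powr \<nu> * Gamma (\<nu> - real n + 1)) * (bessel_aux \<nu> n m * w ^ m)
           = of_real (bessel_coeff \<nu> n m) * w ^ m" for m w
    unfolding bessel_aux_eq_coeff[OF assms(1), symmetric] by (simp only: mult.assoc)
  show sm: "summable (\<lambda>m. complex_of_real (bessel_coeff \<nu> n m) * w ^ m)" for w
    using summable_mult[OF S, of "of_real (2 powr \<nu> * Gamma (\<nu> - real n + 1))" w]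
    unfolding eq .
  show "P w = of_real (2 powr \<nu> * Gamma (\<nu> - real n + 1)) * (\<Sum>m. bessel_aux \<nu> n m * w ^ m)"
    unfolding P_def using suminf_mult[OF S, of "of_real (2 powr \<nu> * Gamma (\<nu> - real n + 1))" w]
    unfolding eq .
  show "P holomorphic_on UNIV"
    unfolding P_def
    using termdiffs_strong_converges_everywhere[of "\<lambda>m. complex_of_real (bessel_coeff \<nu> n m)", OF sm]
    by (auto simp: holomorphic_on_open)
qed

lemma bessel_g_properties:
  assumes "\<nu> > real n - 1"
  shows bessel_g_holomorphic: "bessel_g \<nu> n holomorphic_on UNIV"
    and bessel_g_eq: "z \<notin> \<real>\<^sub>\<le>\<^sub>0 \<Longrightarrow> bessel_g \<nu> n z =
          of_real (2 powr \<nu> * Gamma (\<nu> - real n + 1))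
            * z powr of_real (1 + real n - \<nu>) * (deriv ^^ n) (bessel_J \<nu>) z"
    and bessel_g_sums: "(\<lambda>m. of_real (bessel_coeff \<nu> n m) * z ^ (2 * m + 1)) sums bessel_g \<nu> n z"
proof -
  have \<nu>: "\<nu> > -1" using assms by linarith
  define P where "P w = (\<Sum>m. complex_of_real (bessel_coeff \<nu> n m) * w ^ m)" for w
  have P: "P holomorphic_on UNIV"
    unfolding P_def by (rule bessel_series_holomorphic[OF assms])
  have hol: "(\<lambda>z. z * P (z\<^sup>2)) holomorphic_on UNIV"
    by (intro holomorphic_intros holomorphic_on_compose_gen[OF _ P, unfolded o_def]) auto
  have eq: "z * P (z\<^sup>2) = of_real (2 powr \<nu> * Gamma (\<nu> - real n + 1))
       * z powr of_real (1 + real n - \<nu>) * (deriv ^^ n) (bessel_J \<nu>) z" if "z \<notin> \<real>\<^sub>\<le>\<^sub>0" for z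
  proof -
    have "z powr of_real (1 + real n - \<nu>) * z powr of_real (\<nu> - real n) = z"
      using that by (subst powr_add[symmetric]) auto
    then have "C * z powr of_real (1 + real n - \<nu>) * (z powr of_real (\<nu> - real n) * S) = z * (C * S)"
      for C S by (metis mult.assoc mult.left_commute)
    then show ?thesis
      unfolding P_def bessel_series_eq[OF assms] deriv_bessel_J[OF \<nu> that] by (rule sym)
  qed
  have g: "bessel_g \<nu> n = (\<lambda>z. z * P (z\<^sup>2))"
    unfolding bessel_g_def by (rule entire_extension_eqI[OF hol eq])
  show "bessel_g \<nu> n holomorphic_on UNIV" using hol g by simp
  show "bessel_g \<nu> n z = of_real (2 powr \<nu> * Gamma (\<nu> - real n + 1))
       * z powr of_real (1 + real n - \<nu>) * (deriv ^^ n) (bessel_J \<nu>) z" if "z \<notin> \<real>\<^sub>\<le>\<^sub>0"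
    using eq[OF that] g by simp
  show "(\<lambda>m. of_real (bessel_coeff \<nu> n m) * z ^ (2 * m + 1)) sums bessel_g \<nu> n z"
    using sums_mult[OF summable_sums[OF bessel_coeff_summable[OF assms, of "z\<^sup>2"]], of z]
    unfolding g P_def by (simp add: power_mult mult_ac power2_eq_square power_mult_distrib)
qed

lemma bessel_h_properties:
  assumes "\<nu> > real n - 1"
  shows bessel_h_holomorphic: "bessel_h \<nu> n holomorphic_on UNIV"
    and bessel_h_eq: "z \<notin> \<real>\<^sub>\<le>\<^sub>0 \<Longrightarrow> bessel_h \<nu> n z =
          of_real (2 powr \<nu> * Gamma (\<nu> - real n + 1))
            * z powr of_real (1 + (real n - \<nu>) / 2) * (deriv ^^ n) (bessel_J \<nu>) (csqrt z)"
    and bessel_h_sums: "(\<lambda>m. of_real (bessel_coeff \<nu> n m) * z ^ (m + 1)) sums bessel_h \<nu> n z"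
proof -
  have \<nu>: "\<nu> > -1" using assms by linarith
  define P where "P w = (\<Sum>m. complex_of_real (bessel_coeff \<nu> n m) * w ^ m)" for w
  have P: "P holomorphic_on UNIV"
    unfolding P_def by (rule bessel_series_holomorphic[OF assms])
  have hol: "(\<lambda>z. z * P z) holomorphic_on UNIV"
    by (intro holomorphic_intros P)
  have eq: "z * P z = of_real (2 powr \<nu> * Gamma (\<nu> - real n + 1))
       * z powr of_real (1 + (real n - \<nu>) / 2) * (deriv ^^ n) (bessel_J \<nu>) (csqrt z)"
    if "z \<notin> \<real>\<^sub>\<le>\<^sub>0" for z
  proof -
    have z: "z \<noteq> 0" using that by auto
    have c: "csqrt z \<notin> \<real>\<^sub>\<le>\<^sub>0" using z by simp
    have "Ln (csqrt z) = Ln z / 2"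
      unfolding csqrt_exp_Ln[OF z]
      using mpi_less_Im_Ln[OF z] Im_Ln_le_pi[OF z] pi_gt_zero
      by (intro Ln_exp) (auto simp del: pi_gt_zero)
    then have L: "Ln z = 2 * Ln (csqrt z)" by (simp add: mult.commute)
    have "csqrt z powr of_real (\<nu> - real n) = z powr of_real ((\<nu> - real n) / 2)"
      using z by (simp add: powr_def L)
    moreover have "z powr of_real (1 + (real n - \<nu>) / 2) * z powr of_real ((\<nu> - real n) / 2)
        = z powr of_real ((1 + (real n - \<nu>) / 2) + (\<nu> - real n) / 2)"
      unfolding of_real_add by (simp only: powr_add)
    moreover have "(1 + (real n - \<nu>) / 2) + (\<nu> - real n) / 2 = 1"
      by (simp add: field_simps)
    ultimately have "z powr of_real (1 + (real n - \<nu>) / 2) * csqrt z powr of_real (\<nu> - real n) = z"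
      using z by simp
    then have "C * z powr of_real (1 + (real n - \<nu>) / 2) * (csqrt z powr of_real (\<nu> - real n) * S)
        = z * (C * S)" for C S
      by (metis mult.assoc mult.left_commute)
    then show ?thesis
      unfolding P_def bessel_series_eq[OF assms] deriv_bessel_J[OF \<nu> c] power2_csqrt by (rule sym)
  qed
  have h: "bessel_h \<nu> n = (\<lambda>z. z * P z)"
    unfolding bessel_h_def by (rule entire_extension_eqI[OF hol eq])
  show "bessel_h \<nu> n holomorphic_on UNIV" using hol h by simp
  show "bessel_h \<nu> n z = of_real (2 powr \<nu> * Gamma (\<nu> - real n + 1))
       * z powr of_real (1 + (real n - \<nu>) / 2) * (deriv ^^ n) (bessel_J \<nu>) (csqrt z)" if "z \<notin> \<real>\<^sub>\<le>\<^sub>0"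
    using eq[OF that] h by simp
  show "(\<lambda>m. of_real (bessel_coeff \<nu> n m) * z ^ (m + 1)) sums bessel_h \<nu> n z"
    using sums_mult[OF summable_sums[OF bessel_coeff_summable[OF assms, of z]], of z]
    unfolding h P_def by (simp add: mult_ac)
qed

end

theory Submission
  imports Defs
begin

text \<open>
  The coefficients of \<open>g'\<close> and of \<open>(z g')'\<close> (in the variable \<open>z\<^sup>2\<close>), and likewise for \<open>h\<close> (in \<open>z\<close>), are
  obtained from the series of the Bessel function by operators \<open>1 + l x d/dx\<close> with \<open>l > 0\<close>. By Rolle,
  these preserve polynomials with simple positive roots, so all the series are coefficientwise limits
  of such polynomials, starting from the Laguerre polynomials. The coefficients of
  \<open>- C' / C\<close> for such a limit \<open>C\<close> are therefore limits of power sums \<open>\<Sum> t\<^sup>k\<close> over positive numbers \<open>t\<close>, the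
  reciprocal roots, and inherit their inequalities; in this way no information on the zeros of the
  entire functions themselves is required. Let \<open>U = \<Sum> u\<^sub>k x\<^sup>k\<close> be this series for
  \<open>C = F = Q + l x Q'\<close>, where \<open>g' z = Q (z\<^sup>2)\<close>, \<open>l = 2\<close> or \<open>h' z = Q z\<close>, \<open>l = 1\<close>.
  Lower bound: \<open>u\<^sub>k \<le> u\<^sub>0 (sqrt u\<^sub>1)\<^sup>k\<close>, so \<open>F\<close> has no zero for \<open>|x| < 1 / sqrt u\<^sub>1\<close>, a radius larger than
  \<open>1 / u\<^sub>0\<close>; and \<open>- x Q' / Q\<close> has nonnegative coefficients, so the real part of
  \<open>1 + l x Q' / Q = F / Q\<close> is smallest on the positive axis.
  Upper bound: if \<open>F\<close> has no zero for \<open>|x| < r\<close> then \<open>U\<close> converges there, and log-convexity of \<open>u\<close> gives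
  \<open>r \<le> u\<^sub>1 / u\<^sub>2 < u\<^sub>0 / u\<^sub>1\<close>.
\<close>

section \<open>Polynomials with simple positive roots\<close>

lemma coeff_pCons_0_pderiv: "coeff (pCons 0 (pderiv p)) m = of_nat m * coeff p m"
  by (cases m) (simp_all add: coeff_pderiv)

text \<open>The weight is an integrating factor: it turns the operator
  \<open>c - d x + x d/dx\<close> into a plain derivative. The case \<open>d = 0\<close> yields the
  operators \<open>1 + l x d/dx\<close>, the case \<open>d = 1\<close> the Laguerre
  recursion.\<close>

lemma DERIV_weighted_poly:
  fixes p :: "real poly"
  assumes "x > 0"
  shows "((\<lambda>x. x powr c * exp (- d * x) * poly p x) has_real_derivative
           x powr (c - 1) * exp (- d * x) * poly ([:c, -d:] * p + pCons 0 (pderiv p)) x) (at x)"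
proof -
  have "x powr c = x powr (c - 1) * x"
    using assms by (simp add: powr_diff)
  with assms show ?thesis
    by (auto intro!: derivative_eq_intros simp: algebra_simps)
qed

text \<open>Since \<open>c > 0\<close>, the weight vanishes at 0, so 0 serves as an extra zero
  although \<open>p\<close> need not vanish there.\<close>

lemma weighted_Rolle:
  fixes p :: "real poly"
  assumes c: "c > 0" and ab: "0 \<le> a" "a < b" and a: "a = 0 \<or> poly p a = 0" and b: "poly p b = 0"
  shows "\<exists>x. a < x \<and> x < b \<and> poly ([:c, -d:] * p + pCons 0 (pderiv p)) x = 0"
proof -
  define f where "f x = x powr c * exp (- d * x) * poly p x" for x
  have D: "(f has_real_derivative x powr (c - 1) * exp (- d * x)
      * poly ([:c, -d:] * p + pCons 0 (pderiv p)) x) (at x)" if "x > 0" for x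
    using DERIV_weighted_poly[OF that, of c d p] by (simp add: f_def [abs_def])
  have "\<exists>x>a. x < b \<and> DERIV f x :> 0"
  proof (rule Rolle[OF ab(2)])
    show "f a = f b" using a b c by (auto simp: f_def)
    show "continuous_on {a..b} f"
      unfolding f_def using c ab by (intro continuous_intros continuous_on_powr') auto
    show "f differentiable (at x)" if "a < x" "x < b" for x
      using D[of x] that ab real_differentiable_def by auto
  qed
  then obtain x where x: "a < x" "x < b" "DERIV f x :> 0" by blast
  then have "x powr (c - 1) * exp (- d * x) * poly ([:c, -d:] * p + pCons 0 (pderiv p)) x = 0"
    using D[of x] ab DERIV_unique by fastforce
  with x ab show ?thesis by force
qed

text \<open>Each point of \<open>A\<close> is paired with its predecessor in \<open>A\<close>, or
  with 0 for the least one; the roots found in these gaps are increasing, hence distinct. The clause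
  \<open>y < a\<close> later separates them from a root beyond all of \<open>A\<close>.\<close>

lemma weighted_Rolle_roots:
  fixes p :: "real poly"
  assumes c: "c > 0" and A: "finite A" "\<And>x. x \<in> A \<Longrightarrow> x > 0 \<and> poly p x = 0"
  shows "\<exists>B. card B = card A \<and> finite B
    \<and> (\<forall>y\<in>B. 0 < y \<and> (\<exists>a\<in>A. y < a) \<and> poly ([:c, -d:] * p + pCons 0 (pderiv p)) y = 0)"
proof -
  define pr where "pr a = Max (insert 0 {b \<in> A. b < a})" for a
  have fin: "finite (insert 0 {b \<in> A. b < a})" for a using A by simp
  have pr0: "0 \<le> pr a" for a unfolding pr_def using fin by (intro Max_ge) auto
  have pr: "pr a < a" "pr a = 0 \<or> poly p (pr a) = 0" if "a \<in> A" for a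
  proof -
    have "pr a \<in> insert 0 {b \<in> A. b < a}"
      unfolding pr_def by (intro Max_in fin) auto
    then show "pr a < a" "pr a = 0 \<or> poly p (pr a) = 0" using A(2) that by auto
  qed
  have "\<forall>a\<in>A. \<exists>x. pr a < x \<and> x < a \<and> poly ([:c, -d:] * p + pCons 0 (pderiv p)) x = 0"
    using weighted_Rolle[OF c pr0 pr] A(2) by blast
  then obtain r where r: "\<And>a. a \<in> A \<Longrightarrow> pr a < r a \<and> r a < a \<and>
      poly ([:c, -d:] * p + pCons 0 (pderiv p)) (r a) = 0" by metis
  have less: "r a < r b" if "a \<in> A" "b \<in> A" "a < b" for a b
  proof -
    have "a \<le> pr b" unfolding pr_def using that by (intro Max_ge fin) auto
    then show ?thesis using r[OF that(1)] r[OF that(2)] by linarith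
  qed
  have "inj_on r A"
    by (rule inj_onI) (metis less less_irrefl linorder_neqE_linordered_idom)
  then have "card (r ` A) = card A" by (rule card_image)
  moreover have "0 < r a" if "a \<in> A" for a using r[OF that] pr0[of a] by linarith
  ultimately show ?thesis
    using A r by (intro exI[of _ "r ` A"]) auto
qed

text \<open>Rolle on the unbounded interval beyond the largest root, where the weight
  \<open>x powr c * exp (-x)\<close> makes the function tend to 0 at infinity.\<close>

lemma weighted_Rolle_infinity:
  fixes p :: "real poly"
  assumes c: "c > 0" and M: "0 \<le> M" "M = 0 \<or> poly p M = 0" and ne: "\<And>x. x > M \<Longrightarrow> poly p x \<noteq> 0"
  shows "\<exists>x>M. poly ([:c, -1:] * p + pCons 0 (pderiv p)) x = 0"
proof -
  define f where "f x = x powr c * exp (- x) * poly p x" for x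
  have D: "(f has_real_derivative x powr (c - 1) * exp (- x)
      * poly ([:c, -1:] * p + pCons 0 (pderiv p)) x) (at x)" if "x > 0" for x
    using DERIV_weighted_poly[OF that, of c 1 p] by (simp add: f_def [abs_def])
  have lim: "(f \<longlongrightarrow> 0) at_top"
  proof -
    have 1: "((\<lambda>x. x powr c * exp (- x) * (coeff p i * x ^ i)) \<longlongrightarrow> 0) at_top" for i
    proof -
      have "((\<lambda>x::real. x powr c * exp (- x) * x ^ i) \<longlongrightarrow> 0) at_top" using c by real_asymp
      from tendsto_mult_left[OF this, of "coeff p i"] show ?thesis by (simp add: mult_ac)
    qed
    have "((\<lambda>x. \<Sum>i\<le>degree p. x powr c * exp (- x) * (coeff p i * x ^ i)) \<longlongrightarrow> (\<Sum>i\<le>degree p. 0)) at_top"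
      by (intro tendsto_sum 1)
    then show ?thesis by (simp add: f_def [abs_def] poly_altdef sum_distrib_left)
  qed
  define v where "v = f (M + 1)"
  have nz: "f x \<noteq> 0" if "x > M" for x using ne[OF that] that M by (simp add: f_def)
  then have v: "v \<noteq> 0" by (simp add: v_def)
  from tendstoD[OF lim, of "\<bar>v\<bar>"] v have "eventually (\<lambda>x. \<bar>f x\<bar> < \<bar>v\<bar>) at_top"
    by (simp add: dist_real_def)
  from eventually_happens[OF eventually_conj[OF this eventually_gt_at_top[of "M + 1"]]]
  obtain y where y: "\<bar>f y\<bar> < \<bar>v\<bar>" "y > M + 1" by auto
  have cont: "continuous_on {M..y} (\<lambda>x. (f x)\<^sup>2)"
    unfolding f_def using c M by (intro continuous_intros continuous_on_powr') auto
  \<comment> \<open>The sign of \<open>f\<close> is unknown, so its square is used. It is 0 at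
    \<open>M\<close>, and smaller at \<open>y\<close> than at \<open>M + 1\<close>; hence its value
    at \<open>y\<close> is already taken in \<open>[M, M + 1]\<close>, and Rolle applies between
    these two points.\<close>
  have "\<exists>z. M \<le> z \<and> z \<le> M + 1 \<and> (f z)\<^sup>2 = (f y)\<^sup>2"
  proof (rule IVT')
    show "(f M)\<^sup>2 \<le> (f y)\<^sup>2" using M(2) c by (auto simp: f_def)
    show "(f y)\<^sup>2 \<le> (f (M + 1))\<^sup>2" using y(1) by (simp add: v_def abs_le_square_iff[symmetric])
    show "continuous_on {M..M + 1} (\<lambda>x. (f x)\<^sup>2)"
      by (rule continuous_on_subset[OF cont]) (use y in auto)
  qed auto
  then obtain z where z: "M \<le> z" "z \<le> M + 1" "(f z)\<^sup>2 = (f y)\<^sup>2" by blast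
  have D2: "((\<lambda>x. (f x)\<^sup>2) has_real_derivative 2 * f x * (x powr (c - 1) * exp (- x)
      * poly ([:c, -1:] * p + pCons 0 (pderiv p)) x)) (at x)" if "x > 0" for x
    by (rule derivative_eq_intros D that refl)+ (simp add: algebra_simps)
  have "\<exists>x>z. x < y \<and> DERIV (\<lambda>x. (f x)\<^sup>2) x :> 0"
  proof (rule Rolle)
    show "continuous_on {z..y} (\<lambda>x. (f x)\<^sup>2)" by (rule continuous_on_subset[OF cont]) (use z in auto)
    show "(\<lambda>x. (f x)\<^sup>2) differentiable (at x)" if "z < x" "x < y" for x
      using D2[of x] that z M real_differentiable_def by auto
  qed (use z y in auto)
  then obtain x where x: "z < x" "x < y" "DERIV (\<lambda>x. (f x)\<^sup>2) x :> 0" by blast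
  then have x0: "x > 0" "x > M" using z M by auto
  have "2 * f x * (x powr (c - 1) * exp (- x)
      * poly ([:c, -1:] * p + pCons 0 (pderiv p)) x) = 0"
    using D2[OF x0(1)] x(3) DERIV_unique by blast
  with nz[OF x0(2)] x0 show ?thesis by auto
qed

text \<open>A polynomial has no more roots than its degree, so the count forces all roots, complex
  ones included, to be positive and simple. The normalization makes \<open>p\<close> a product of
  factors \<open>1 - t x\<close> over the reciprocal roots \<open>t\<close> and excludes
  \<open>p = 0\<close>.\<close>

definition simple_positive_roots :: "real poly \<Rightarrow> bool" where
  "simple_positive_roots p \<longleftrightarrow> coeff p 0 = 1 \<and> card {x. x > 0 \<and> poly p x = 0} = degree p"

lemma simple_positive_rootsI:
  assumes "coeff p 0 = 1" "finite B" "degree p \<le> card B" "\<And>x. x \<in> B \<Longrightarrow> x > 0 \<and> poly p x = 0"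
  shows "simple_positive_roots p"
proof -
  have p: "p \<noteq> 0" using assms by auto
  have fin: "finite {x. x > 0 \<and> poly p x = 0}"
    using poly_roots_finite[OF p] by (rule rev_finite_subset) auto
  have "card {x. x > 0 \<and> poly p x = 0} \<le> card {x. poly p x = 0}"
    using poly_roots_finite[OF p] by (intro card_mono) auto
  also have "\<dots> \<le> degree p" by (rule card_poly_roots_bound[OF p])
  finally have "card {x. x > 0 \<and> poly p x = 0} \<le> degree p" .
  moreover have "card B \<le> card {x. x > 0 \<and> poly p x = 0}"
    using fin assms(4) by (intro card_mono) auto
  ultimately show ?thesis using assms by (simp add: simple_positive_roots_def)
qed

lemma simple_positive_roots_finite:
  assumes "simple_positive_roots p"
  shows "p \<noteq> 0" "finite {x. x > 0 \<and> poly p x = 0}"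
proof -
  show p: "p \<noteq> 0" using assms by (auto simp: simple_positive_roots_def)
  show "finite {x. x > 0 \<and> poly p x = 0}"
    using poly_roots_finite[OF p] by (rule rev_finite_subset) auto
qed

text \<open>Up to the factor \<open>l\<close> this is the weighted operator with
  \<open>c = 1 / l\<close> and \<open>d = 0\<close>. Rolle yields as many positive roots as
  \<open>p\<close> has, and the degree does not grow.\<close>

lemma simple_positive_roots_theta:
  assumes p: "simple_positive_roots p" and l: "l > 0"
  shows "simple_positive_roots (p + smult l (pCons 0 (pderiv p)))"
proof -
  let ?A = "{x. x > 0 \<and> poly p x = 0}"
  note [simp] = simple_positive_roots_finite[OF p]
  have "\<exists>B. card B = card ?A \<and> finite B \<and> (\<forall>y\<in>B. 0 < y \<and> (\<exists>a\<in>?A. y < a)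
      \<and> poly ([:1/l, -0:] * p + pCons 0 (pderiv p)) y = 0)"
    by (rule weighted_Rolle_roots) (use l in simp_all)
  then obtain B where B: "card B = card ?A" "finite B"
    "\<forall>y\<in>B. 0 < y \<and> poly ([:1/l, -0:] * p + pCons 0 (pderiv p)) y = 0"
    by blast
  have B0: "poly (p + smult l (pCons 0 (pderiv p))) y = 0" if "y \<in> B" for y
  proof -
    have "(1 / l) * poly p y + y * poly (pderiv p) y = 0" using B(3) that by force
    then show ?thesis using l by (simp add: field_simps)
  qed
  show ?thesis
  proof (rule simple_positive_rootsI[OF _ B(2)])
    show "coeff (p + smult l (pCons 0 (pderiv p))) 0 = 1"
      using p by (simp add: simple_positive_roots_def)
    show "degree (p + smult l (pCons 0 (pderiv p))) \<le> card B"
    proof (rule degree_le, intro allI impI)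
      fix i assume "card B < i"
      then have "coeff p i = 0"
        using p B(1) by (simp add: simple_positive_roots_def coeff_eq_0)
      then show "coeff (p + smult l (pCons 0 (pderiv p))) i = 0"
        unfolding coeff_add coeff_smult coeff_pCons_0_pderiv by simp
    qed
    show "x > 0 \<and> poly (p + smult l (pCons 0 (pderiv p))) x = 0" if "x \<in> B" for x
      using B(3) B0 that by blast
  qed
qed

lemma simple_positive_roots_scale:
  assumes p: "simple_positive_roots p" and s: "s > 0"
  shows "simple_positive_roots (pcompose p [:0, s:])"
proof -
  let ?A = "{x. x > 0 \<and> poly p x = 0}"
  note [simp] = simple_positive_roots_finite[OF p]
  show ?thesis
  proof (rule simple_positive_rootsI)
    show "coeff (pcompose p [:0, s:]) 0 = 1"
      using p by (simp add: simple_positive_roots_def poly_0_coeff_0)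
    show "finite ((\<lambda>x. x / s) ` ?A)" by simp
    have "card ((\<lambda>x. x / s) ` ?A) = card ?A"
      by (rule card_image) (use s in \<open>auto simp: inj_on_def\<close>)
    then show "degree (pcompose p [:0, s:]) \<le> card ((\<lambda>x. x / s) ` ?A)"
      using p s degree_pcompose[of p "[:0, s:]"] by (simp add: simple_positive_roots_def)
  qed (use s in \<open>auto simp: poly_pcompose\<close>)
qed

text \<open>The Laguerre polynomials of parameter \<open>\<nu>\<close> divided by their value at 0. The recursion
  \<open>normalized_laguerre_Suc\<close> is the Rodrigues formula in disguise: up to a factor, it applies
  \<open>x powr (- N - \<nu>) * exp x * d/dx\<close> to \<open>x powr (N + 1 + \<nu>) * exp (-x)\<close> times the polynomial.\<close>

definition normalized_laguerre :: "real \<Rightarrow> nat \<Rightarrow> real poly" where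
  "normalized_laguerre \<nu> N = (\<Sum>m\<le>N. monom ((-1) ^ m * real (N choose m) / pochhammer (\<nu> + 1) m) m)"

lemma coeff_normalized_laguerre:
  "coeff (normalized_laguerre \<nu> N) m = (-1) ^ m * real (N choose m) / pochhammer (\<nu> + 1) m"
  by (simp add: normalized_laguerre_def coeff_sum binomial_eq_0)

lemma normalized_laguerre_Suc:
  assumes "\<nu> > -1"
  shows "normalized_laguerre \<nu> (Suc N) = smult (1 / (real N + 1 + \<nu>))
     ([:real N + 1 + \<nu>, -1:] * normalized_laguerre \<nu> N + pCons 0 (pderiv (normalized_laguerre \<nu> N)))"
proof (rule poly_eqI)
  fix m
  have N: "real N + 1 + \<nu> > 0" using assms by linarith
  show "coeff (normalized_laguerre \<nu> (Suc N)) m = coeff (smult (1 / (real N + 1 + \<nu>))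
     ([:real N + 1 + \<nu>, -1:] * normalized_laguerre \<nu> N + pCons 0 (pderiv (normalized_laguerre \<nu> N)))) m"
  proof (cases m)
    case 0
    then show ?thesis using N by (simp add: coeff_normalized_laguerre)
  next
    case (Suc k)
    define P where "P = pochhammer (\<nu> + 1) k"
    define x where "x = real N + 1 + \<nu>"
    have x: "x > 0" using N by (simp add: x_def)
    have P: "P > 0" unfolding P_def using assms by (intro pochhammer_pos) simp
    have k: "\<nu> + 1 + real k > 0" using assms by linarith
    have "Suc k * (N choose Suc k) = (N - k) * (N choose k)"
      by (metis binomial_absorb_comp mult.commute binomial_absorption)
    then have "real (Suc k) * real (N choose Suc k) = real (N - k) * real (N choose k)"
      by (metis of_nat_mult)
    \<comment> \<open>The subtraction \<open>N - k\<close> truncates for \<open>k > N\<close>, but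
      there the binomial coefficient is 0.\<close>
    then have *: "real (Suc k) * real (N choose Suc k) = (real N - real k) * real (N choose k)"
      by (cases "k \<le> N") (simp_all add: binomial_eq_0)
    have "coeff (smult (1 / x)
        ([:x, -1:] * normalized_laguerre \<nu> N + pCons 0 (pderiv (normalized_laguerre \<nu> N)))) (Suc k)
      = 1 / x * ((x + real (Suc k)) * coeff (normalized_laguerre \<nu> N) (Suc k) - coeff (normalized_laguerre \<nu> N) k)"
      by (simp add: coeff_pderiv algebra_simps)
    also have "\<dots> = (-1) ^ Suc k * (1 / x * ((x + real (Suc k)) * real (N choose Suc k)
         + (\<nu> + 1 + real k) * real (N choose k))) / (P * (\<nu> + 1 + real k))"
      using P k by (simp add: coeff_normalized_laguerre pochhammer_Suc P_def[symmetric] divide_simps)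
         (simp add: algebra_simps)
    \<comment> \<open>By \<open>*\<close>, \<open>(k + 1) * (N choose (k + 1))\<close> becomes
      \<open>(N - k) * (N choose k)\<close>; both binomials then carry the factor \<open>x\<close>,
      and Pascal's rule adds them.\<close>
    also have "(x + real (Suc k)) * real (N choose Suc k) + (\<nu> + 1 + real k) * real (N choose k)
       = x * real (Suc N choose Suc k)"
      using * by (simp add: x_def algebra_simps)
    finally show ?thesis
      using x by (simp add: Suc coeff_normalized_laguerre pochhammer_Suc P_def x_def)
  qed
qed

text \<open>The gaps between 0 and the \<open>N\<close> roots yield \<open>N\<close> new roots, all
  below the largest old root \<open>M\<close>; the decay of the weight at infinity yields one more
  beyond \<open>M\<close>.\<close>

lemma simple_positive_roots_normalized_laguerre:
  assumes \<nu>: "\<nu> > -1"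
  shows "simple_positive_roots (normalized_laguerre \<nu> N)"
proof (induction N)
  case 0
  show ?case by (simp add: simple_positive_roots_def normalized_laguerre_def monom_0)
next
  case (Suc N)
  let ?p = "normalized_laguerre \<nu> N"
  let ?A = "{x. x > 0 \<and> poly ?p x = 0}"
  have cN: "real N + 1 + \<nu> > 0" using \<nu> by linarith
  note [simp] = simple_positive_roots_finite[OF Suc]
  have deg: "degree (normalized_laguerre \<nu> N) \<le> N" "degree (normalized_laguerre \<nu> (Suc N)) \<le> Suc N" for N
    by (rule degree_le, simp add: coeff_normalized_laguerre binomial_eq_0)+
  have "coeff (normalized_laguerre \<nu> N) N \<noteq> 0"
    using pochhammer_pos[of "\<nu> + 1" N] \<nu> by (auto simp: coeff_normalized_laguerre)
  then have degN: "degree ?p = N" using deg(1) by (intro antisym le_degree) auto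
  have "\<exists>B. card B = card ?A \<and> finite B \<and> (\<forall>y\<in>B. 0 < y \<and> (\<exists>a\<in>?A. y < a)
      \<and> poly ([:real N + 1 + \<nu>, -1:] * ?p + pCons 0 (pderiv ?p)) y = 0)"
    by (rule weighted_Rolle_roots) (use cN in simp_all)
  then obtain B where B: "card B = card ?A" "finite B"
    "\<forall>y\<in>B. 0 < y \<and> (\<exists>a\<in>?A. y < a) \<and> poly ([:real N + 1 + \<nu>, -1:] * ?p + pCons 0 (pderiv ?p)) y = 0"
    by blast
  define M where "M = Max (insert 0 ?A)"
  have M: "M \<in> insert 0 ?A"
    unfolding M_def by (rule Max_in) simp_all
  have M_ge: "x \<le> M" if "x \<in> insert 0 ?A" for x
    unfolding M_def by (rule Max_ge) (use that in simp_all)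
  have "\<exists>x>M. poly ([:real N + 1 + \<nu>, -1:] * ?p + pCons 0 (pderiv ?p)) x = 0"
  proof (rule weighted_Rolle_infinity[OF cN])
    show M0: "0 \<le> M" using M_ge by blast
    show "M = 0 \<or> poly ?p M = 0" using M by blast
    show "poly ?p x \<noteq> 0" if "x > M" for x using M_ge[of x] M0 that by fastforce
  qed
  then obtain x where x: "x > M" "poly ([:real N + 1 + \<nu>, -1:] * ?p + pCons 0 (pderiv ?p)) x = 0"
    by blast
  have xB: "x \<notin> B" using B(3) M_ge x(1) by (metis insertCI less_le_trans less_asym)
  show ?case
  proof (rule simple_positive_rootsI[where B = "insert x B"])
    show "coeff (normalized_laguerre \<nu> (Suc N)) 0 = 1" by (simp add: coeff_normalized_laguerre)
    show "finite (insert x B)" using B by simp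
    show "degree (normalized_laguerre \<nu> (Suc N)) \<le> card (insert x B)"
      using deg(2) xB B(1,2) Suc degN by (simp add: simple_positive_roots_def)
    have "x > 0" using M_ge[of 0] x(1) by simp
    then show "y > 0 \<and> poly (normalized_laguerre \<nu> (Suc N)) y = 0" if "y \<in> insert x B" for y
      using that x(2) B(3) unfolding normalized_laguerre_Suc[OF \<nu>] poly_smult by auto
  qed
qed

text \<open>Coefficientwise limits suffice because each coefficient of \<open>- C' / C\<close>
  depends on finitely many coefficients of \<open>C\<close>. The limits are the Taylor coefficients
  of functions of Laguerre-Polya type, \<open>exp (- a x)\<close> times a product of factors
  \<open>1 - t x\<close> with nonnegative \<open>a\<close> and \<open>t\<close>.\<close>

definition positive_root_limit :: "(nat \<Rightarrow> real) \<Rightarrow> bool" where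
  "positive_root_limit c \<longleftrightarrow>
     (\<exists>p. (\<forall>N::nat. simple_positive_roots (p N)) \<and> (\<forall>m. (\<lambda>N. coeff (p N) m) \<longlonglongrightarrow> c m))"

lemma positive_root_limit_theta:
  assumes "positive_root_limit c" and l: "l > 0"
  shows "positive_root_limit (\<lambda>m. (1 + l * real m) * c m)"
proof -
  obtain p where p: "\<And>N::nat. simple_positive_roots (p N)" "\<And>m. (\<lambda>N. coeff (p N) m) \<longlonglongrightarrow> c m"
    using assms by (auto simp: positive_root_limit_def)
  have co: "coeff (q + smult l (pCons 0 (pderiv q))) m = (1 + l * real m) * coeff q m" for q m
    unfolding coeff_add coeff_smult coeff_pCons_0_pderiv by (simp add: algebra_simps)
  have "(\<lambda>N. coeff (p N + smult l (pCons 0 (pderiv (p N)))) m) \<longlonglongrightarrow> (1 + l * real m) * c m" for m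
    unfolding co by (intro tendsto_intros p(2))
  then show ?thesis
    unfolding positive_root_limit_def
    by (intro exI[of _ "\<lambda>N. p N + smult l (pCons 0 (pderiv (p N)))"])
       (simp add: simple_positive_roots_theta p(1) l del: smult_pCons)
qed

lemma positive_root_limit_prod_theta:
  fixes n :: nat
  assumes "positive_root_limit c" and l: "\<forall>i<n. l i > 0"
  shows "positive_root_limit (\<lambda>m. (\<Prod>i<n. 1 + l i * real m) * c m)"
  using l
proof (induction n)
  case (Suc n)
  have "positive_root_limit (\<lambda>m. (1 + l n * real m) * ((\<Prod>i<n. 1 + l i * real m) * c m))"
    by (rule positive_root_limit_theta) (use Suc in auto)
  then show ?case by (simp add: mult_ac)
qed (use assms(1) in simp)

lemma coeff_pcompose_scale:
  fixes p :: "'a :: comm_semiring_1 poly"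
  shows "coeff (pcompose p [:0, s:]) m = s ^ m * coeff p m"
proof (induction p arbitrary: m)
  case (pCons a p)
  then show ?case
    by (cases m) (simp_all add: pcompose_pCons coeff_pCons mult_ac)
qed simp

section \<open>From Laguerre polynomials to the Bessel series and its derivatives\<close>

lemma choose_over_power_tendsto:
  "(\<lambda>N. real (Suc N choose m) / real (Suc N) ^ m) \<longlonglongrightarrow> 1 / fact m"
proof -
  have "(\<lambda>N. (\<Prod>i<m. (1 - real i / real (Suc N))) / fact m) \<longlonglongrightarrow> (\<Prod>i<m. 1 - 0) / fact m"
    by (intro tendsto_intros LIMSEQ_Suc[OF lim_const_over_n]) simp
  moreover have "real (Suc N choose m) / real (Suc N) ^ m = (\<Prod>i<m. (1 - real i / real (Suc N))) / fact m" for N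
  proof -
    have "real (Suc N choose m) = (\<Prod>i<m. real (Suc N) - real i) / fact m"
      by (simp add: binomial_gbinomial gbinomial_prod_rev atLeast0LessThan del: of_nat_Suc)
    also have "(\<Prod>i<m. real (Suc N) - real i) = (\<Prod>i<m. real (Suc N) * (1 - real i / real (Suc N)))"
      by (intro prod.cong) (auto simp: field_simps)
    also have "\<dots> = real (Suc N) ^ m * (\<Prod>i<m. (1 - real i / real (Suc N)))"
      by (simp only: prod.distrib prod_constant card_lessThan)
    finally show ?thesis by simp
  qed
  ultimately show ?thesis by simp
qed

text \<open>A coefficientwise form of the Mehler-Heine limit: Laguerre polynomials at
  \<open>x / (4 N)\<close> tend to the series of
  \<open>Gamma (\<nu> + 1) * (2 / z) powr \<nu> * J z\<close> in \<open>x = z\<^sup>2\<close>, where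
  \<open>J\<close> is the Bessel function of order \<open>\<nu>\<close>. Using \<open>Suc N\<close>
  keeps the scale finite.\<close>

lemma positive_root_limit_bessel:
  assumes \<nu>: "\<nu> > -1"
  shows "positive_root_limit (\<lambda>m. (-1) ^ m / (fact m * 4 ^ m * pochhammer (\<nu> + 1) m))"
proof -
  define p where "p N = pcompose (normalized_laguerre \<nu> (Suc N)) [:0, 1 / (4 * real (Suc N)):]" for N
  have "simple_positive_roots (p N)" for N
    unfolding p_def by (intro simple_positive_roots_scale simple_positive_roots_normalized_laguerre \<nu>) simp
  moreover have "(\<lambda>N. coeff (p N) m) \<longlonglongrightarrow> (-1) ^ m / (fact m * 4 ^ m * pochhammer (\<nu> + 1) m)" for m
  proof -
    have "coeff (p N) m = (real (Suc N choose m) / real (Suc N) ^ m) * ((-1) ^ m / (4 ^ m * pochhammer (\<nu> + 1) m))" for N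
      by (simp only: p_def coeff_pcompose_scale coeff_normalized_laguerre power_one_over power_divide power_mult_distrib)
         (simp add: mult_ac)
    moreover have "(\<lambda>N. (real (Suc N choose m) / real (Suc N) ^ m) * ((-1) ^ m / (4 ^ m * pochhammer (\<nu> + 1) m)))
        \<longlonglongrightarrow> 1 / fact m * ((-1) ^ m / (4 ^ m * pochhammer (\<nu> + 1) m))"
      by (intro tendsto_mult_right choose_over_power_tendsto)
    ultimately show ?thesis by (simp add: mult_ac)
  qed
  ultimately show ?thesis by (auto simp: positive_root_limit_def)
qed

text \<open>The derivative of index \<open>i\<close> multiplies the term of exponent
  \<open>2 m + \<nu> - i\<close> by that exponent; divided by its value at \<open>m = 0\<close> this
  is \<open>1 + l m\<close> with \<open>l = 2 / (\<nu> - i)\<close>, positive because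
  \<open>\<nu> > n - 1\<close>. So \<open>n\<close> derivatives amount to \<open>n\<close>
  root-preserving operators.\<close>

lemma bessel_coeff_eq_prod:
  assumes "\<nu> > real n - 1"
  shows "bessel_coeff \<nu> n m = (\<Prod>i<n. 1 + 2 / (\<nu> - real i) * real m)
           * ((-1) ^ m / (fact m * 4 ^ m * pochhammer (\<nu> + 1) m))"
proof -
  have pos: "\<nu> - real i > 0" if "i < n" for i
  proof -
    have "real i \<le> real n - 1" using that by linarith
    then show ?thesis using assms by linarith
  qed
  have \<nu>: "\<nu> + 1 > 0" using assms by linarith
  have G: "Gamma (\<nu> + 1) > 0" "Gamma (\<nu> - real n + 1) > 0" using assms by (auto intro!: Gamma_real_pos)
  have "(\<Prod>i<n. 1 + 2 / (\<nu> - real i) * real m) = (\<Prod>i<n. ((2 * real m + \<nu>) - real i) / (\<nu> - real i))"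
    by (intro prod.cong refl) (use pos in \<open>force simp: field_simps\<close>)
  also have "\<dots> = (\<Prod>i<n. (2 * real m + \<nu>) - real i) / (\<Prod>i<n. \<nu> - real i)"
    by (rule prod_dividef)
  also have "(\<Prod>i<n. (2 * real m + \<nu>) - real i) = Gamma (2 * real m + \<nu> + 1) / Gamma (2 * real m + \<nu> - real n + 1)"
    by (rule prod_eq_Gamma_quotient) (use assms in simp)
  also have "(\<Prod>i<n. \<nu> - real i) = Gamma (\<nu> + 1) / Gamma (\<nu> - real n + 1)"
    by (rule prod_eq_Gamma_quotient) (use assms in simp)
  finally have 1: "(\<Prod>i<n. 1 + 2 / (\<nu> - real i) * real m) =
    Gamma (2 * real m + \<nu> + 1) * Gamma (\<nu> - real n + 1) / (Gamma (2 * real m + \<nu> - real n + 1) * Gamma (\<nu> + 1))"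
    by simp
  have 2: "pochhammer (\<nu> + 1) m = Gamma (\<nu> + 1 + real m) / Gamma (\<nu> + 1)"
    using \<nu> by (intro pochhammer_Gamma) (auto simp: nonpos_Ints_def)
  show ?thesis
    unfolding 1 2 bessel_coeff_def using G by (simp add: mult_ac add_ac algebra_simps)
qed

lemma positive_root_limit_bessel_coeff:
  assumes "\<nu> > real n - 1"
  shows "positive_root_limit (bessel_coeff \<nu> n)"
proof -
  have "positive_root_limit (\<lambda>m. (\<Prod>i<n. 1 + 2 / (\<nu> - real i) * real m)
           * ((-1) ^ m / (fact m * 4 ^ m * pochhammer (\<nu> + 1) m)))"
  proof (rule positive_root_limit_prod_theta[OF positive_root_limit_bessel])
    show "\<nu> > -1" using assms by linarith
    show "\<forall>i<n. 2 / (\<nu> - real i) > 0"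
    proof (intro allI impI)
      fix i assume "i < n"
      then have "real i \<le> real n - 1" by linarith
      then show "2 / (\<nu> - real i) > 0" using assms by simp
    qed
  qed
  then show ?thesis by (simp add: bessel_coeff_eq_prod[OF assms, abs_def])
qed

section \<open>Power sums of the reciprocal roots\<close>

text \<open>A formal series, so it is available before anything is known about convergence or zeros.
  For a product of factors \<open>1 - t x\<close> the coefficient of index \<open>k\<close> is the
  power sum of exponent \<open>k + 1\<close>.\<close>

definition neg_log_deriv :: "(nat \<Rightarrow> real) \<Rightarrow> real fps" where
  "neg_log_deriv c = - fps_deriv (Abs_fps c) * inverse (Abs_fps c)"

lemma neg_log_deriv_mult:
  "c 0 = 1 \<Longrightarrow> neg_log_deriv c * Abs_fps c = - fps_deriv (Abs_fps c)"
  by (simp add: neg_log_deriv_def mult.assoc inverse_mult_eq_1)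

text \<open>Newton's identities, read off from the product with \<open>Abs_fps c\<close>. Each
  coefficient depends on finitely many of the \<open>c\<close>, so coefficientwise limits carry
  over.\<close>

lemma neg_log_deriv_rec:
  assumes "c 0 = 1"
  shows "fps_nth (neg_log_deriv c) m = - ((real m + 1) * c (Suc m)) - (\<Sum>i<m. fps_nth (neg_log_deriv c) i * c (m - i))"
proof -
  have "(\<Sum>i\<le>m. fps_nth (neg_log_deriv c) i * c (m - i)) = - ((real m + 1) * c (Suc m))"
    using arg_cong[OF neg_log_deriv_mult[where c = c, OF assms], of "\<lambda>f. fps_nth f m"]
    unfolding fps_mult_nth atLeast0AtMost by simp
  then show ?thesis
    unfolding lessThan_Suc_atMost[symmetric] sum.lessThan_Suc diff_self_eq_0 assms by linarith
qed

lemma neg_log_deriv_tendsto: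
  assumes "\<And>N::nat. p N 0 = 1" "c 0 = 1" "\<And>m. (\<lambda>N. p N m) \<longlonglongrightarrow> c m"
  shows "(\<lambda>N. fps_nth (neg_log_deriv (p N)) m) \<longlonglongrightarrow> fps_nth (neg_log_deriv c) m"
proof (induction m rule: less_induct)
  case (less m)
  have "(\<lambda>N. - ((real m + 1) * p N (Suc m)) - (\<Sum>i<m. fps_nth (neg_log_deriv (p N)) i * p N (m - i)))
      \<longlonglongrightarrow> - ((real m + 1) * c (Suc m)) - (\<Sum>i<m. fps_nth (neg_log_deriv c) i * c (m - i))"
    by (intro tendsto_intros assms(3) less) auto
  then show ?case
    by (simp only: neg_log_deriv_rec[of "p N" m for N, OF assms(1), symmetric]
        neg_log_deriv_rec[of c m, OF assms(2), symmetric])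
qed

text \<open>Both sides have degree at most \<open>card A\<close> and agree at
  \<open>card A + 1\<close> points: the roots and 0.\<close>

lemma simple_positive_roots_eq_prod:
  assumes "simple_positive_roots p"
  shows "\<exists>T. finite T \<and> (\<forall>t\<in>T. t > 0) \<and> p = (\<Prod>t\<in>T. [:1, -t:])"
proof -
  define A where "A = {x. x > 0 \<and> poly p x = 0}"
  have fin: "finite A" and card: "card A = degree p" and c0: "coeff p 0 = 1"
    using assms simple_positive_roots_finite[OF assms] by (auto simp: A_def simple_positive_roots_def)
  have deg: "degree (\<Prod>x\<in>A. [:1, - inverse x:]) \<le> card A"
  proof -
    have "(\<Sum>x\<in>A. degree [:1, - inverse x:]) \<le> (\<Sum>x\<in>A. 1)"
      by (intro sum_mono) simp
    then show ?thesis
      using degree_prod_sum_le[OF fin, of "\<lambda>x. [:1, - inverse x:]"] by simp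
  qed
  have "p = (\<Prod>x\<in>A. [:1, - inverse x:])"
  proof (rule poly_eqI_degree[of "insert 0 A"])
    fix x assume "x \<in> insert 0 A"
    then show "poly p x = poly (\<Prod>x\<in>A. [:1, - inverse x:]) x"
    proof
      assume "x = 0"
      moreover have "poly p 0 = 1" using c0 by (simp add: poly_0_coeff_0)
      moreover have "poly (\<Prod>x\<in>A. [:1, - inverse x:]) 0 = 1" unfolding poly_prod by simp
      ultimately show ?thesis by simp
    next
      assume x: "x \<in> A"
      then have "poly (\<Prod>x\<in>A. [:1, - inverse x:]) x = 0"
        using fin by (auto simp: poly_prod A_def intro!: bexI[of _ x])
      with x show ?thesis by (simp add: A_def)
    qed
  next
    have "0 \<notin> A" by (simp add: A_def)
    then show "degree p < card (insert 0 A)" "degree (\<Prod>x\<in>A. [:1, - inverse x:]) < card (insert 0 A)"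
      using fin card deg by simp_all
  qed
  also have "\<dots> = (\<Prod>t\<in>inverse ` A. [:1, -t:])"
    by (subst prod.reindex) (auto intro: inj_onI)
  finally show ?thesis
    using fin by (intro exI[of _ "inverse ` A"]) (auto simp: A_def)
qed

text \<open>The factor \<open>1 - t x\<close> contributes the geometric series
  \<open>t / (1 - t x)\<close>, and logarithmic derivatives add. The induction runs on the undivided
  equation \<open>S T * P T = - fps_deriv (P T)\<close>; cancelling recovers the quotient.\<close>

lemma neg_log_deriv_prod:
  assumes "finite T"
  shows "fps_nth (neg_log_deriv (coeff (\<Prod>t\<in>T. [:1, -t:]))) k = (\<Sum>t\<in>T. t ^ Suc k)"
proof -
  define P where "P T = fps_of_poly (\<Prod>t\<in>T. [:1, -t::real:])" for T
  define S where "S T = Abs_fps (\<lambda>k. \<Sum>t\<in>T. t ^ Suc k :: real)" for T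
  have main: "S T * P T = - fps_deriv (P T) \<and> fps_nth (P T) 0 = 1"
    using assms
  proof (induction T rule: finite_induct)
    case empty
    show ?case by (simp add: S_def P_def fps_eq_iff)
  next
    case (insert t T)
    define G where "G = Abs_fps (\<lambda>k. t ^ Suc k)"
    define L where "L = 1 - fps_const t * fps_X"
    have G: "G * L = fps_const t"
    proof (rule fps_ext)
      fix k
      have "G * L = G - fps_const t * (fps_X * G)" by (simp add: L_def right_diff_distrib mult_ac)
      then show "fps_nth (G * L) k = fps_nth (fps_const t) k"
        by (cases k) (simp_all add: G_def)
    qed
    have "S (insert t T) = G + S T"
      using insert by (simp add: S_def G_def fps_eq_iff)
    moreover have "P (insert t T) = L * P T"
      using insert by (simp add: P_def L_def fps_of_poly_mult fps_of_poly_pCons mult_ac flip: fps_const_neg)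
    moreover have "fps_deriv L = - fps_const t" by (simp add: L_def)
    moreover have "(G + S T) * (L * P T) = (G * L) * P T + L * (S T * P T)" by (simp add: algebra_simps)
    moreover have "fps_nth L 0 = 1" by (simp add: L_def)
    moreover have "fps_deriv (L * P T) = fps_deriv L * P T + L * fps_deriv (P T)" by simp
    moreover have "fps_const (- t) * P T = - (fps_const t * P T)" by (simp flip: fps_const_neg)
    ultimately show ?case using insert.IH G by simp
  qed
  define c where "c = coeff (\<Prod>t\<in>T. [:1, -t:])"
  have cP: "Abs_fps c = P T" by (simp add: c_def P_def fps_of_poly_def)
  have c0: "c 0 = 1" using main unfolding cP[symmetric] by simp
  have "S T * Abs_fps c = neg_log_deriv c * Abs_fps c"
    using main neg_log_deriv_mult[where c = c, OF c0] by (simp add: cP)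
  moreover have "Abs_fps c \<noteq> 0" using c0 by (metis fps_nth_Abs_fps fps_zero_nth zero_neq_one)
  ultimately have "neg_log_deriv c = S T" by simp
  then show ?thesis unfolding c_def by (simp add: S_def)
qed

lemma positive_root_limit_0:
  assumes "positive_root_limit c"
  shows "c 0 = 1"
proof -
  obtain p where p: "\<And>N::nat. simple_positive_roots (p N)" "\<And>m. (\<lambda>N. coeff (p N) m) \<longlonglongrightarrow> c m"
    using assms by (auto simp: positive_root_limit_def)
  have "(\<lambda>N. coeff (p N) 0) = (\<lambda>_. 1)" using p(1) by (auto simp: simple_positive_roots_def)
  with p(2)[of 0] show ?thesis by (simp add: LIMSEQ_const_iff)
qed

text \<open>The passage by which weak inequalities between finite power sums of positive numbers
  reach \<open>neg_log_deriv c\<close>.\<close>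

lemma positive_root_limit_power_sums:
  assumes "positive_root_limit c"
  shows "\<exists>T. (\<forall>N::nat. finite (T N) \<and> (\<forall>t\<in>T N. t > 0)) \<and>
     (\<forall>k. (\<lambda>N. \<Sum>t\<in>T N. t ^ Suc k) \<longlonglongrightarrow> fps_nth (neg_log_deriv c) k)"
proof -
  obtain p where p: "\<And>N::nat. simple_positive_roots (p N)" "\<And>m. (\<lambda>N. coeff (p N) m) \<longlonglongrightarrow> c m"
    using assms by (auto simp: positive_root_limit_def)
  obtain T where T: "\<And>N. finite (T N) \<and> (\<forall>t\<in>T N. t > 0) \<and> p N = (\<Prod>t\<in>T N. [:1, -t:])"
    using simple_positive_roots_eq_prod[OF p(1)] by metis
  have "(\<lambda>N. fps_nth (neg_log_deriv (coeff (p N))) k) \<longlonglongrightarrow> fps_nth (neg_log_deriv c) k" for k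
    by (rule neg_log_deriv_tendsto)
       (use p positive_root_limit_0[OF assms] in \<open>simp_all add: simple_positive_roots_def\<close>)
  moreover have "fps_nth (neg_log_deriv (coeff (p N))) k = (\<Sum>t\<in>T N. t ^ Suc k)" for N k
    using T[of N] neg_log_deriv_prod by metis
  ultimately show ?thesis using T by (intro exI[of _ T]) simp
qed

section \<open>Inequalities between limits of power sums\<close>

context
  fixes c :: "nat \<Rightarrow> real" and u :: "nat \<Rightarrow> real"
  assumes c: "positive_root_limit c"
  defines "u \<equiv> fps_nth (neg_log_deriv c)"
begin

lemma power_sums_nonneg: "u k \<ge> 0"
proof -
  obtain T where T: "\<And>N::nat. finite (T N)" "\<And>N t. t \<in> T N \<Longrightarrow> t > 0"
    "\<And>k. (\<lambda>N. \<Sum>t\<in>T N. t ^ Suc k) \<longlonglongrightarrow> u k"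
    using positive_root_limit_power_sums[OF c] unfolding u_def by blast
  have "0 \<le> (\<Sum>t\<in>T N. t ^ Suc k)" for N
    by (intro sum_nonneg zero_le_power less_imp_le T(2))
  then show ?thesis by (intro LIMSEQ_le_const[OF T(3)]) auto
qed

text \<open>Cauchy-Schwarz for the vectors of half-integer powers \<open>sqrt t ^ (k + 1)\<close>
  and \<open>sqrt t ^ (k + 3)\<close>.\<close>

lemma power_sums_log_convex: "(u (Suc k))\<^sup>2 \<le> u k * u (Suc (Suc k))"
proof -
  obtain T where T: "\<And>N::nat. finite (T N)" "\<And>N t. t \<in> T N \<Longrightarrow> t > 0"
    "\<And>k. (\<lambda>N. \<Sum>t\<in>T N. t ^ Suc k) \<longlonglongrightarrow> u k"
    using positive_root_limit_power_sums[OF c] unfolding u_def by blast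
  have "(\<Sum>t\<in>T N. t ^ Suc (Suc k))\<^sup>2 \<le> (\<Sum>t\<in>T N. t ^ Suc k) * (\<Sum>t\<in>T N. t ^ Suc (Suc (Suc k)))" for N
  proof -
    have sq: "(\<Sum>t\<in>T N. (sqrt t ^ m)\<^sup>2) = (\<Sum>t\<in>T N. t ^ m)" for m
    proof (rule sum.cong)
      fix t assume "t \<in> T N"
      then have "(sqrt t)\<^sup>2 = t" using T(2) by (simp add: less_imp_le)
      then show "(sqrt t ^ m)\<^sup>2 = t ^ m"
        by (metis power_mult mult.commute)
    qed simp
    have "(\<Sum>t\<in>T N. sqrt t ^ Suc k * sqrt t ^ Suc (Suc (Suc k)))\<^sup>2
        \<le> (\<Sum>t\<in>T N. t ^ Suc k) * (\<Sum>t\<in>T N. t ^ Suc (Suc (Suc k)))"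
      using Cauchy_Schwarz_ineq_sum[of "\<lambda>t. sqrt t ^ Suc k" "\<lambda>t. sqrt t ^ Suc (Suc (Suc k))" "T N"]
      unfolding sq .
    also have "(\<Sum>t\<in>T N. sqrt t ^ Suc k * sqrt t ^ Suc (Suc (Suc k))) = (\<Sum>t\<in>T N. t ^ Suc (Suc k))"
    proof (rule sum.cong)
      fix t assume "t \<in> T N"
      then have "sqrt t * sqrt t = t" using T(2) by (simp add: less_imp_le)
      then have "t ^ Suc (Suc k) = (sqrt t * sqrt t) ^ Suc (Suc k)" by metis
      also have "\<dots> = sqrt t ^ Suc k * sqrt t ^ Suc (Suc (Suc k))"
        unfolding power_mult_distrib by (simp only: power_Suc mult_ac)
      finally show "sqrt t ^ Suc k * sqrt t ^ Suc (Suc (Suc k)) = t ^ Suc (Suc k)" by (rule sym)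
    qed simp
    finally show ?thesis .
  qed
  then show ?thesis
    by (intro LIMSEQ_le[OF tendsto_power[OF T(3)] tendsto_mult[OF T(3) T(3)]]) auto
qed

text \<open>Cauchy-Schwarz with weight \<open>t\<close> for the vectors \<open>t - q\<close> and
  \<open>t ^ k\<close>. If the first factor on the right vanishes, the whole sequence
  \<open>u\<close> is geometric with ratio \<open>q\<close>; this yields the equality case of
  log-convexity.\<close>

lemma power_sums_defect:
  "(u (Suc k) - q * u k)\<^sup>2 \<le> (u 2 - 2 * q * u 1 + q\<^sup>2 * u 0) * u (2 * k)"
proof -
  obtain T where T: "\<And>N::nat. finite (T N)" "\<And>N t. t \<in> T N \<Longrightarrow> t > 0"
    "\<And>k. (\<lambda>N. \<Sum>t\<in>T N. t ^ Suc k) \<longlonglongrightarrow> u k"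
    using positive_root_limit_power_sums[OF c] unfolding u_def by blast
  define s where "s N k = (\<Sum>t\<in>T N. t ^ Suc k)" for N k
  have s: "(\<lambda>N. s N k) \<longlonglongrightarrow> u k" for k using T(3) by (simp add: s_def)
  have "(s N (Suc k) - q * s N k)\<^sup>2 \<le> (s N 2 - 2 * q * s N 1 + q\<^sup>2 * s N 0) * s N (2 * k)" for N
  proof -
    have sq: "(sqrt t)\<^sup>2 = t" "sqrt t * sqrt t = t" if "t \<in> T N" for t
      using T(2) that by (auto simp: less_imp_le)
    have "(\<Sum>t\<in>T N. (sqrt t * (t - q)) * (sqrt t * t ^ k))\<^sup>2
        \<le> (\<Sum>t\<in>T N. (sqrt t * (t - q))\<^sup>2) * (\<Sum>t\<in>T N. (sqrt t * t ^ k)\<^sup>2)"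
      by (rule Cauchy_Schwarz_ineq_sum)
    also have "(\<Sum>t\<in>T N. (sqrt t * (t - q)) * (sqrt t * t ^ k)) = (\<Sum>t\<in>T N. t ^ Suc (Suc k) - q * t ^ Suc k)"
    proof (rule sum.cong)
      fix t assume t: "t \<in> T N"
      have "(sqrt t * (t - q)) * (sqrt t * t ^ k) = (sqrt t * sqrt t) * ((t - q) * t ^ k)"
        by (simp only: mult_ac)
      then show "(sqrt t * (t - q)) * (sqrt t * t ^ k) = t ^ Suc (Suc k) - q * t ^ Suc k"
        unfolding sq(2)[OF t] by (simp add: algebra_simps)
    qed simp
    also have "\<dots> = s N (Suc k) - q * s N k" by (simp add: s_def sum_subtractf sum_distrib_left)
    also have "(\<Sum>t\<in>T N. (sqrt t * (t - q))\<^sup>2) = (\<Sum>t\<in>T N. t ^ Suc 2 - 2 * q * t ^ Suc 1 + q\<^sup>2 * t ^ Suc 0)"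
      by (intro sum.cong refl) (simp add: power_mult_distrib sq, simp add: power2_eq_square power3_eq_cube algebra_simps)
    also have "\<dots> = s N 2 - 2 * q * s N 1 + q\<^sup>2 * s N 0"
      by (simp add: s_def sum_subtractf sum.distrib sum_distrib_left)
    also have "(\<Sum>t\<in>T N. (sqrt t * t ^ k)\<^sup>2) = s N (2 * k)"
      unfolding s_def by (intro sum.cong refl) (simp add: power_mult_distrib sq power_mult mult.commute[of 2] flip: power_mult)
    finally show ?thesis .
  qed
  then show ?thesis
    by (intro LIMSEQ_le[of "\<lambda>N. (s N (Suc k) - q * s N k)\<^sup>2" _ "\<lambda>N. (s N 2 - 2 * q * s N 1 + q\<^sup>2 * s N 0) * s N (2 * k)"]
          tendsto_intros s) auto
qed

text \<open>Each \<open>t\<close> is at most the square root of the sum of all squares, so every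
  factor of \<open>t ^ k\<close> can be replaced by that root.\<close>

lemma power_sums_geometric_bound: "u k \<le> u 0 * sqrt (u 1) ^ k"
proof -
  obtain T where T: "\<And>N::nat. finite (T N)" "\<And>N t. t \<in> T N \<Longrightarrow> t > 0"
    "\<And>k. (\<lambda>N. \<Sum>t\<in>T N. t ^ Suc k) \<longlonglongrightarrow> u k"
    using positive_root_limit_power_sums[OF c] unfolding u_def by blast
  have "(\<Sum>t\<in>T N. t ^ Suc k) \<le> (\<Sum>t\<in>T N. t ^ Suc 0) * sqrt (\<Sum>t\<in>T N. t ^ Suc 1) ^ k" for N
    unfolding sum_distrib_right
  proof (rule sum_mono)
    fix t assume t: "t \<in> T N"
    have "t ^ Suc 1 \<le> (\<Sum>t\<in>T N. t ^ Suc 1)"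
      by (rule member_le_sum[OF t _ T(1)]) (use T(2) in \<open>auto intro: less_imp_le\<close>)
    then have "t \<le> sqrt (\<Sum>t\<in>T N. t ^ Suc 1)"
      by (intro real_le_rsqrt) (simp add: power2_eq_square)
    then have "t ^ k \<le> sqrt (\<Sum>t\<in>T N. t ^ Suc 1) ^ k"
      using T(2)[OF t] by (intro power_mono) auto
    then show "t ^ Suc k \<le> t ^ Suc 0 * sqrt (\<Sum>t\<in>T N. t ^ Suc 1) ^ k"
      using T(2)[OF t] by simp
  qed
  then show ?thesis
    by (intro LIMSEQ_le[OF T(3) tendsto_mult[OF T(3) tendsto_power[OF tendsto_real_sqrt[OF T(3)]]]]) auto
qed

text \<open>Equality would make the power sums geometric, that is \<open>c\<close> the coefficients of
  \<open>(1 - q x) powr (u 0 / q)\<close>, whose signs do not alternate forever.\<close>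

lemma power_sums_strict:
  assumes alt: "\<And>m. c m * c (Suc m) < 0" and u1: "u 1 > 0"
  shows "(u 1)\<^sup>2 < u 0 * u 2"
proof (rule ccontr)
  assume "\<not> (u 1)\<^sup>2 < u 0 * u 2"
  then have eq: "u 0 * u 2 = (u 1)\<^sup>2"
    using power_sums_log_convex[of 0] by (simp add: numeral_2_eq_2)
  have u0: "u 0 > 0"
    using power_sums_nonneg[of 0] eq u1 by (cases "u 0 = 0") auto
  \<comment> \<open>With this \<open>q\<close> the defect, multiplied by \<open>u 0\<close>, is
    \<open>u 0 * u 2 - (u 1)\<^sup>2\<close>, which is 0 by assumption.\<close>
  define q where "q = u 1 / u 0"
  have q: "q > 0" using u0 u1 by (simp add: q_def)
  have "u 0 * (u 2 - 2 * q * u 1 + q\<^sup>2 * u 0) = u 0 * u 2 - (u 1)\<^sup>2"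
    using u0 by (simp add: q_def power2_eq_square field_simps)
  then have "u 2 - 2 * q * u 1 + q\<^sup>2 * u 0 = 0" using eq u0 by simp
  then have geo: "u (Suc k) = q * u k" for k
    using power_sums_defect[of k q] by simp
  define C where "C = Abs_fps c"
  define U where "U = neg_log_deriv c"
  have c0: "c 0 = 1" by (rule positive_root_limit_0[OF c])
  have UC: "U * C = - fps_deriv C" unfolding U_def C_def by (rule neg_log_deriv_mult) (rule c0)
  \<comment> \<open>The geometric relation sums to \<open>U = u 0 / (1 - q x)\<close>, so that
    \<open>U C = - C'\<close> becomes a two-term recursion for \<open>c\<close>.\<close>
  have "U - fps_const q * (fps_X * U) = fps_const (u 0)"
  proof (rule fps_ext)
    fix k show "fps_nth (U - fps_const q * (fps_X * U)) k = fps_nth (fps_const (u 0)) k"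
      using geo by (cases k) (simp_all add: U_def u_def)
  qed
  then have "fps_const (u 0) * C = U * C - fps_const q * (fps_X * (U * C))"
    by (metis (no_types, opaque_lifting) left_diff_distrib mult.assoc)
  then have eqC: "fps_const (u 0) * C = fps_const q * (fps_X * fps_deriv C) - fps_deriv C"
    unfolding UC by simp
  have rec: "u 0 * c m = q * (real m * c m) - (real m + 1) * c (Suc m)" for m
    using arg_cong[OF eqC, of "\<lambda>f. fps_nth f m"] by (cases m) (simp_all add: C_def)
  \<comment> \<open>The recursion gives \<open>c (Suc m) / c m = (q * m - u 0) / (m + 1)\<close>,
    and alternating signs keep this negative for every \<open>m\<close>.\<close>
  have "q * real m < u 0" for m
  proof -
    have "(real m + 1) * (c m * c (Suc m)) < 0"
      using alt[of m] by (simp add: mult_less_0_iff)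
    moreover have "(real m + 1) * (c m * c (Suc m)) = (q * real m - u 0) * (c m)\<^sup>2"
      using arg_cong[OF rec[of m], of "\<lambda>x. x * c m"] by (simp add: power2_eq_square algebra_simps)
    ultimately have "(q * real m - u 0) * (c m)\<^sup>2 < 0" by simp
    then show ?thesis by (auto simp: mult_less_0_iff)
  qed
  moreover obtain m where "real m > u 0 / q" using reals_Archimedean2 by blast
  ultimately show False using q by (metis less_asym mult.commute pos_divide_less_eq)
qed

end

lemma neg_log_deriv_0_1:
  assumes "c 0 = 1"
  shows "fps_nth (neg_log_deriv c) 0 = - c 1"
    and "fps_nth (neg_log_deriv c) 1 = (c 1)\<^sup>2 - 2 * c 2"
proof -
  show 0: "fps_nth (neg_log_deriv c) 0 = - c 1" using neg_log_deriv_rec[of c 0] assms by simp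
  show "fps_nth (neg_log_deriv c) 1 = (c 1)\<^sup>2 - 2 * c 2"
    using neg_log_deriv_rec[of c 1] assms 0 by (simp add: power2_eq_square numeral_2_eq_2)
qed

text \<open>With \<open>A = l x V\<close> one has \<open>F = (1 - A) Q\<close>, hence
  \<open>U - V = A' / (1 - A)\<close>. Here \<open>A\<close> has nonnegative coefficients and
  constant term 0, so the fixed-point equation \<open>D\<close> gives nonnegativity by induction on
  the index.\<close>

lemma neg_log_deriv_theta_mono:
  assumes q0: "q 0 = 1" and l: "l > 0" and V: "\<And>k. fps_nth (neg_log_deriv q) k \<ge> 0"
  shows "fps_nth (neg_log_deriv q) k \<le> fps_nth (neg_log_deriv (\<lambda>m. (1 + l * real m) * q m)) k"
proof -
  define f where "f m = (1 + l * real m) * q m" for m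
  define Q F V U where "Q = Abs_fps q" and "F = Abs_fps f" and "V = neg_log_deriv q" and "U = neg_log_deriv f"
  define A where "A = fps_const l * (fps_X * V)"
  have VQ: "V * Q = - fps_deriv Q" unfolding V_def Q_def by (rule neg_log_deriv_mult) (rule q0)
  have UF: "U * F = - fps_deriv F" unfolding U_def F_def by (rule neg_log_deriv_mult) (simp add: f_def q0)
  have "F = Q + fps_const l * (fps_X * fps_deriv Q)"
  proof (rule fps_ext)
    fix k show "fps_nth F k = fps_nth (Q + fps_const l * (fps_X * fps_deriv Q)) k"
      by (cases k) (simp_all add: F_def Q_def f_def algebra_simps)
  qed
  also have "fps_deriv Q = - (V * Q)" using VQ by simp
  finally have F: "F = (1 - A) * Q" by (simp add: A_def algebra_simps)
  have "U * ((1 - A) * Q) = fps_deriv A * Q - (1 - A) * fps_deriv Q"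
    using UF unfolding F by simp
  also have "fps_deriv Q = - (V * Q)" using VQ by simp
  finally have "(U * (1 - A)) * Q = (fps_deriv A + (1 - A) * V) * Q" by (simp add: algebra_simps)
  moreover have "Q \<noteq> 0" using q0 unfolding Q_def by (metis fps_nth_Abs_fps fps_zero_nth zero_neq_one)
  ultimately have "U * (1 - A) = fps_deriv A + (1 - A) * V" by simp
  then have D: "U - V = fps_deriv A + A * (U - V)" by (simp add: algebra_simps)
  have A: "fps_nth A k \<ge> 0" "fps_nth A 0 = 0" for k
    using l assms(3) by (cases k; simp add: A_def V_def)+
  have "fps_nth (U - V) k \<ge> 0"
  proof (induction k rule: less_induct)
    case (less k)
    have "fps_nth A i * fps_nth (U - V) (k - i) \<ge> 0" if "i \<le> k" for i
      using A less[of "k - i"] that by (cases "i = 0") auto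
    then have "fps_nth (A * (U - V)) k \<ge> 0"
      unfolding fps_mult_nth by (intro sum_nonneg) auto
    then show ?case using A(1)[of "Suc k"] by (subst D) simp
  qed
  then show ?thesis by (simp add: U_def V_def f_def [abs_def])
qed

section \<open>The quotient \<open>1 + l w Q' / Q\<close> of an entire function\<close>

definition fps_complex :: "real fps \<Rightarrow> complex fps" where
  "fps_complex f = Abs_fps (\<lambda>m. of_real (fps_nth f m))"

lemma fps_nth_complex [simp]: "fps_nth (fps_complex f) m = of_real (fps_nth f m)"
  by (simp add: fps_complex_def)

lemma fps_complex_mult: "fps_complex (f * g) = fps_complex f * fps_complex g"
  by (simp add: fps_eq_iff fps_mult_nth)

lemma fps_complex_neg_deriv: "fps_complex (- fps_deriv f) = - fps_deriv (fps_complex f)"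
  by (simp add: fps_eq_iff)

lemma neg_log_deriv_complex:
  assumes "c 0 = 1"
  shows "fps_complex (neg_log_deriv c) * fps_complex (Abs_fps c) = - fps_deriv (fps_complex (Abs_fps c))"
  by (simp only: neg_log_deriv_mult[where c = c, OF assms] flip: fps_complex_mult fps_complex_neg_deriv)

lemma fps_conv_radius_complex_ge:
  assumes s: "s > 0" and bd: "\<And>k. \<bar>fps_nth f k\<bar> \<le> K * s ^ k"
  shows "fps_conv_radius (fps_complex f) \<ge> ereal (1 / s)"
  unfolding fps_conv_radius_def
proof (rule conv_radius_geI_ex')
  fix r :: real assume r: "0 < r" "ereal r < ereal (1 / s)"
  then have "s * r < 1" using s by (simp add: field_simps)
  then have "summable (\<lambda>k. K * (s * r) ^ k)"
    using s r by (intro summable_mult summable_geometric) auto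
  then show "summable (\<lambda>k. fps_nth (fps_complex f) k * of_real r ^ k)"
  proof (rule summable_comparison_test')
    fix k :: nat
    have "\<bar>fps_nth f k\<bar> * r ^ k \<le> (K * s ^ k) * r ^ k" using r by (intro mult_right_mono bd) auto
    then show "norm (fps_nth (fps_complex f) k * of_real r ^ k) \<le> K * (s * r) ^ k"
      using r by (simp add: norm_mult norm_power power_mult_distrib mult_ac)
  qed
qed

text \<open>If \<open>W\<close> is a primitive of \<open>U\<close> on the disc, then
  \<open>C * exp W\<close> has derivative 0, so it keeps its nonzero value at the origin.\<close>

lemma eval_fps_nonzero_of_log_deriv:
  fixes C U :: "complex fps"
  assumes UC: "U * C = - fps_deriv C" and C0: "fps_nth C 0 \<noteq> 0"
    and r: "fps_conv_radius C \<ge> ereal r" "fps_conv_radius U \<ge> ereal r" and w: "norm w < r"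
  shows "eval_fps C w \<noteq> 0"
proof -
  have less: "ereal (norm z) < fps_conv_radius C" "ereal (norm z) < fps_conv_radius U" if "z \<in> ball 0 r" for z
  proof -
    have "ereal (norm z) < ereal r" using that by simp
    then show "ereal (norm z) < fps_conv_radius C" "ereal (norm z) < fps_conv_radius U"
      using r by (blast intro: less_le_trans)+
  qed
  have "eval_fps U holomorphic_on ball 0 r"
    by (rule holomorphic_on_eval_fps) (use less in \<open>auto simp: in_eball_iff\<close>)
  then obtain W where W: "\<And>x. x \<in> ball 0 r \<Longrightarrow> (W has_field_derivative eval_fps U x) (at x within ball 0 r)"
    using holomorphic_convex_primitive'[of "ball 0 r" "eval_fps U"] by auto
  have "\<exists>k. \<forall>x\<in>ball 0 r. eval_fps C x * exp (W x) = k"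
  proof (rule has_field_derivative_zero_constant)
    fix x :: complex assume x: "x \<in> ball 0 r"
    have "eval_fps (U * C) x = eval_fps U x * eval_fps C x"
      by (rule eval_fps_mult) (use less[OF x] in auto)
    then have "- eval_fps (fps_deriv C) x = eval_fps U x * eval_fps C x"
      unfolding UC by (simp add: eval_fps_minus less[OF x] less_le_trans[OF less(1)[OF x] fps_conv_radius_deriv])
    then have "eval_fps (fps_deriv C) x = - (eval_fps U x * eval_fps C x)"
      by (metis minus_minus)
    moreover have "((\<lambda>x. eval_fps C x * exp (W x)) has_field_derivative
       eval_fps (fps_deriv C) x * exp (W x) + exp (W x) * eval_fps U x * eval_fps C x) (at x within ball 0 r)"
      by (intro DERIV_mult has_field_derivative_eval_fps DERIV_chain2[where f = exp] DERIV_exp W x less)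
    ultimately show "((\<lambda>x. eval_fps C x * exp (W x)) has_field_derivative 0) (at x within ball 0 r)"
      by (simp add: mult_ac)
  qed simp
  then obtain k where k: "\<And>x. x \<in> ball 0 r \<Longrightarrow> eval_fps C x * exp (W x) = k" by blast
  have "r > 0" using w norm_ge_zero[of w] by linarith
  then have "k \<noteq> 0" using k[of 0] C0 by (auto simp: eval_fps_at_0)
  then show ?thesis using k[of w] w by auto
qed

context
  fixes q :: "nat \<Rightarrow> real" and l :: real
  assumes q: "positive_root_limit q" and l: "l > 0"
    and entire: "fps_conv_radius (fps_complex (Abs_fps q)) = \<infinity>"
begin

private definition f where "f m = (1 + l * real m) * q m" for m
private definition u where "u = fps_nth (neg_log_deriv f)"
private definition v where "v = fps_nth (neg_log_deriv q)"
private definition Q where "Q = fps_complex (Abs_fps q)"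
private definition F where "F = fps_complex (Abs_fps f)"

private lemma f: "positive_root_limit f"
  unfolding f_def [abs_def] by (rule positive_root_limit_theta[OF q l])

private lemma F_eq: "F = Q + fps_const (of_real l) * (fps_X * fps_deriv Q)"
proof (rule fps_ext)
  fix k show "fps_nth F k = fps_nth (Q + fps_const (of_real l) * (fps_X * fps_deriv Q)) k"
    by (cases k) (simp_all add: F_def Q_def f_def algebra_simps)
qed

private lemma conv_Q: "fps_conv_radius Q = \<infinity>" "fps_conv_radius (fps_deriv Q) = \<infinity>"
  using entire fps_conv_radius_deriv[of Q] by (simp_all add: Q_def)

private lemma conv_F: "fps_conv_radius F = \<infinity>"
proof -
  have X: "fps_conv_radius (fps_X * fps_deriv Q) = \<infinity>"
    using fps_conv_radius_mult[of fps_X "fps_deriv Q"] conv_Q by simp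
  have "fps_conv_radius (fps_const (of_real l) * (fps_X * fps_deriv Q)) = \<infinity>"
    using fps_conv_radius_mult[of "fps_const (of_real l)" "fps_X * fps_deriv Q"] X by simp
  then show ?thesis
    using fps_conv_radius_add[of Q "fps_const (of_real l) * (fps_X * fps_deriv Q)"] conv_Q by (simp add: F_eq)
qed

private lemma eval_F: "eval_fps F w = eval_fps Q w + of_real l * w * eval_fps (fps_deriv Q) w"
proof -
  have X: "fps_conv_radius (fps_X * fps_deriv Q) = \<infinity>"
    using fps_conv_radius_mult[of fps_X "fps_deriv Q"] conv_Q by simp
  have C: "fps_conv_radius (fps_const (of_real l) * (fps_X * fps_deriv Q)) = \<infinity>"
    using fps_conv_radius_mult[of "fps_const (of_real l)" "fps_X * fps_deriv Q"] X by simp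
  show ?thesis
    unfolding F_eq by (subst eval_fps_add; (subst eval_fps_mult)?; simp add: C X conv_Q eval_fps_mult mult.assoc)
qed

private lemma log_deriv_F: "fps_complex (neg_log_deriv f) * F = - fps_deriv F"
  unfolding F_def by (rule neg_log_deriv_complex[where c = f]) (rule positive_root_limit_0[OF f])

private lemma log_deriv_Q: "fps_complex (neg_log_deriv q) * Q = - fps_deriv Q"
  unfolding Q_def by (rule neg_log_deriv_complex[where c = q]) (rule positive_root_limit_0[OF q])

text \<open>The factorization \<open>N * Q = F\<close> makes \<open>N\<close> and \<open>Q\<close>
  zero-free where \<open>F\<close> is. On the positive axis the real function \<open>N\<close>
  starts at 1 and cannot reach 0, so it stays positive; elsewhere its real part is at least its
  value at \<open>norm w\<close>.\<close>

lemma starlike_quotient_pos: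
  assumes u1: "fps_nth (neg_log_deriv (\<lambda>m. (1 + l * real m) * q m)) 1 > 0"
    and w: "norm w < 1 / sqrt (fps_nth (neg_log_deriv (\<lambda>m. (1 + l * real m) * q m)) 1)"
  shows "eval_fps (fps_complex (Abs_fps q)) w \<noteq> 0"
    and "Re (1 + of_real l * w * eval_fps (fps_deriv (fps_complex (Abs_fps q))) w
            / eval_fps (fps_complex (Abs_fps q)) w) > 0"
proof -
  define s where "s = sqrt (u 1)"
  have u1: "u 1 > 0" and w: "norm w < 1 / s"
    using u1 w by (simp_all add: u_def s_def f_def [abs_def])
  have s: "s > 0" using u1 by (simp add: s_def)
  have ubd: "0 \<le> u k" "u k \<le> u 0 * s ^ k" for k
    unfolding u_def s_def by (rule power_sums_nonneg[OF f] power_sums_geometric_bound[OF f])+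
  have vu: "0 \<le> v k" "v k \<le> u k" for k
    unfolding u_def v_def f_def [abs_def]
    by (rule power_sums_nonneg[OF q] neg_log_deriv_theta_mono positive_root_limit_0[OF q] l)+
  \<comment> \<open>The bound for \<open>u\<close> passes to \<open>v\<close>, so both logarithmic
    derivatives converge in the disc of radius \<open>1 / s\<close>.\<close>
  have vbd: "v k \<le> u 0 * s ^ k" for k using vu(2)[of k] ubd(2)[of k] by linarith
  define U V where "U = fps_complex (neg_log_deriv f)" and "V = fps_complex (neg_log_deriv q)"
  have convU: "fps_conv_radius U \<ge> ereal (1 / s)" and convV: "fps_conv_radius V \<ge> ereal (1 / s)"
    unfolding U_def V_def
    by (rule fps_conv_radius_complex_ge[OF s, of _ "u 0"], use ubd vu vbd in \<open>simp add: u_def v_def\<close>)+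
  have F0: "eval_fps F z \<noteq> 0" if "norm z < 1 / s" for z
    by (rule eval_fps_nonzero_of_log_deriv[OF log_deriv_F[folded U_def] _ _ convU that])
       (simp_all add: conv_F, simp add: F_def positive_root_limit_0[OF f])
  define N where "N z = 1 - of_real l * z * eval_fps V z" for z
  have inV: "ereal (norm z) < fps_conv_radius V" if "norm z < 1 / s" for z
    using convV that by (meson ereal_less_eq less_ereal.simps(1) less_le_trans)
  have Q': "eval_fps (fps_deriv Q) z = - (eval_fps V z * eval_fps Q z)" if "norm z < 1 / s" for z
  proof -
    have "eval_fps (V * Q) z = eval_fps V z * eval_fps Q z"
      by (rule eval_fps_mult) (use inV[OF that] conv_Q in auto)
    then have "- eval_fps (fps_deriv Q) z = eval_fps V z * eval_fps Q z"
      unfolding log_deriv_Q[folded V_def] by (simp add: eval_fps_minus conv_Q)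
    then show ?thesis by (metis minus_minus)
  qed
  have NQ: "N z * eval_fps Q z = eval_fps F z" if "norm z < 1 / s" for z
    unfolding eval_F Q'[OF that] N_def by (simp add: algebra_simps)
  have nz: "N z \<noteq> 0" "eval_fps Q z \<noteq> 0" if "norm z < 1 / s" for z
    using NQ[OF that] F0[OF that] by auto
  show "eval_fps (fps_complex (Abs_fps q)) w \<noteq> 0"
    using nz(2)[OF w] by (simp add: Q_def)
  have sm: "summable (\<lambda>k. v k * x ^ k)" if "0 \<le> x" "x < 1 / s" for x
  proof -
    have "summable (\<lambda>k. norm (fps_nth V k * of_real x ^ k))"
      using that by (intro norm_summable_fps inV) simp
    then show ?thesis
      using that vu(1) by (simp add: V_def v_def norm_mult norm_power)
  qed
  have V_real: "eval_fps V (of_real x) = of_real (\<Sum>k. v k * x ^ k)" if "0 \<le> x" "x < 1 / s" for x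
    using sums_of_real[OF summable_sums[OF sm[OF that]], where ?'a = complex]
    by (simp add: eval_fps_def V_def v_def sums_iff)
  have N_real: "N (of_real x) = of_real (1 - l * x * (\<Sum>k. v k * x ^ k))" if "0 \<le> x" "x < 1 / s" for x
    by (simp add: N_def V_real[OF that])
  have pos: "1 - l * x * (\<Sum>k. v k * x ^ k) > 0" if x: "0 \<le> x" "x < 1 / s" for x
  proof (rule ccontr)
    assume *: "\<not> 1 - l * x * (\<Sum>k. v k * x ^ k) > 0"
    have "eval_fps V holomorphic_on ball 0 (1 / s)"
      by (rule holomorphic_on_eval_fps) (use inV in \<open>auto simp: in_eball_iff\<close>)
    then have "continuous_on (ball 0 (1 / s)) N"
      unfolding N_def by (intro continuous_intros holomorphic_on_imp_continuous_on)
    then have cont: "continuous_on {0..x} (\<lambda>y. Re (N (of_real y)))"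
      by (intro continuous_on_Re continuous_on_compose2[of "ball 0 (1 / s)" N "{0..x}" of_real]
            continuous_on_of_real continuous_on_id) (use x in auto)
    have "\<exists>y\<ge>0. y \<le> x \<and> Re (N (of_real y)) = 0"
      by (rule IVT2'[OF _ _ x(1) cont]) (use * in \<open>simp_all add: N_real[OF x]\<close>, simp add: N_def)
    then obtain y where y: "0 \<le> y" "y \<le> x" "Re (N (of_real y)) = 0" by blast
    then have "y < 1 / s" using x by simp
    with y have "N (of_real y) = 0" using N_real[of y] by simp
    then show False using nz(1)[of "of_real y"] y \<open>y < 1 / s\<close> by simp
  qed
  define x where "x = norm w"
  have x: "0 \<le> x" "x < 1 / s" using w by (simp_all add: x_def)
  have "norm (eval_fps V w) \<le> (\<Sum>k. norm (fps_nth V k * w ^ k))"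
    unfolding eval_fps_def by (rule summable_norm) (rule norm_summable_fps[OF inV[OF w]])
  also have "\<dots> = (\<Sum>k. v k * x ^ k)"
    using vu(1) by (simp add: norm_mult norm_power V_def v_def x_def)
  finally have "l * x * norm (eval_fps V w) \<le> l * x * (\<Sum>k. v k * x ^ k)"
    using l x by (intro mult_left_mono) auto
  moreover have "Re (of_real l * w * eval_fps V w) \<le> l * x * norm (eval_fps V w)"
    using complex_Re_le_cmod[of "of_real l * w * eval_fps V w"] l by (simp add: norm_mult x_def)
  ultimately have "Re (N w) > 0" using pos[OF x] by (simp add: N_def)
  moreover have "1 + of_real l * w * eval_fps (fps_deriv Q) w / eval_fps Q w = N w"
    using nz(2)[OF w] by (simp add: Q'[OF w] N_def)
  ultimately show "Re (1 + of_real l * w * eval_fps (fps_deriv (fps_complex (Abs_fps q))) w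
            / eval_fps (fps_complex (Abs_fps q)) w) > 0"
    by (simp add: Q_def)
qed

text \<open>\<open>F\<close> is \<open>Q\<close> times the quotient, so it has no zero in the disc
  and \<open>- F' / F\<close> converges there. At \<open>x = u 1 / u 2\<close> the terms
  \<open>u k * x ^ k\<close> do not tend to 0, so \<open>x\<close> cannot lie inside.\<close>

lemma starlike_quotient_radius_le:
  assumes u1: "fps_nth (neg_log_deriv (\<lambda>m. (1 + l * real m) * q m)) 1 > 0"
    and u2: "fps_nth (neg_log_deriv (\<lambda>m. (1 + l * real m) * q m)) 2 > 0"
    and nz: "\<And>w. norm w < r \<Longrightarrow> eval_fps (fps_complex (Abs_fps q)) w \<noteq> 0"
    and pos: "\<And>w. norm w < r \<Longrightarrow>
       Re (1 + of_real l * w * eval_fps (fps_deriv (fps_complex (Abs_fps q))) w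
            / eval_fps (fps_complex (Abs_fps q)) w) > 0"
  shows "r \<le> fps_nth (neg_log_deriv (\<lambda>m. (1 + l * real m) * q m)) 1 /
             fps_nth (neg_log_deriv (\<lambda>m. (1 + l * real m) * q m)) 2"
proof -
  have u1: "u 1 > 0" and u2: "u 2 > 0" using u1 u2 by (simp_all add: u_def f_def [abs_def])
  have "eval_fps F w \<noteq> 0" if "norm w < r" for w
  proof
    assume "eval_fps F w = 0"
    then have "eval_fps Q w * (1 + of_real l * w * eval_fps (fps_deriv Q) w / eval_fps Q w) = 0"
      using nz[OF that] by (simp add: eval_F Q_def field_simps)
    then show False using nz[OF that] pos[OF that] by (auto simp: Q_def)
  qed
  then have Finv: "fps_conv_radius (inverse F) \<ge> ereal r"
    using fps_conv_radius_inverse[of "ereal r" F] conv_F by (simp add: min_def split: if_splits)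
  define U where "U = fps_complex (neg_log_deriv f)"
  have "U = U * (F * inverse F)"
    using inverse_mult_eq_1'[of F] positive_root_limit_0[OF f] by (simp add: F_def)
  also have "\<dots> = (U * F) * inverse F" by (simp only: mult.assoc)
  also have "U * F = - fps_deriv F" using log_deriv_F by (simp only: U_def)
  finally have U: "U = - fps_deriv F * inverse F" .
  have "fps_conv_radius (- fps_deriv F) = \<infinity>"
    using fps_conv_radius_deriv[of F] conv_F by simp
  then have convU: "fps_conv_radius U \<ge> ereal r"
    unfolding U using fps_conv_radius_mult[of "- fps_deriv F" "inverse F"] Finv by (simp add: min_def split: if_splits)
  show ?thesis
  proof (rule ccontr)
    define x where "x = u 1 / u 2"
    have x: "x > 0" using u1 u2 by (simp add: x_def)
    assume "\<not> ?thesis"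
    then have "ereal x < ereal r" by (simp add: x_def u_def f_def [abs_def])
    then have "ereal x < fps_conv_radius U" using convU by (rule less_le_trans)
    then have "ereal (norm (complex_of_real x)) < fps_conv_radius U" using x by simp
    then have "summable (\<lambda>k. fps_nth U k * of_real x ^ k)" by (rule summable_fps)
    then have "(\<lambda>k. norm (fps_nth U k * of_real x ^ k)) \<longlonglongrightarrow> 0"
      by (intro tendsto_norm_zero summable_LIMSEQ_zero)
    then have "(\<lambda>k. u k * x ^ k) \<longlonglongrightarrow> 0"
      using x power_sums_nonneg[OF f] by (simp add: U_def u_def norm_mult norm_power)
    then have lim: "(\<lambda>k. u (Suc k) * x ^ Suc k) \<longlonglongrightarrow> 0" by (rule LIMSEQ_Suc)
    \<comment> \<open>By log-convexity the ratios \<open>u (k + 1) / u k\<close> are nondecreasing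
      from \<open>k = 1\<close> on, where the ratio is \<open>1 / x\<close>.\<close>
    have step: "u (Suc k) > 0 \<and> u (Suc (Suc k)) * x \<ge> u (Suc k)" for k
    proof (induction k)
      case 0
      show ?case using u1 u2 by (simp add: x_def numeral_2_eq_2)
    next
      case (Suc k)
      then have "0 < u (Suc (Suc k)) * x" by linarith
      then have p: "u (Suc (Suc k)) > 0" using x by (rule zero_less_mult_pos2)
      have "u (Suc (Suc k)) * u (Suc (Suc k)) \<le> u (Suc k) * u (Suc (Suc (Suc k)))"
        using power_sums_log_convex[OF f, of "Suc k"] by (simp add: u_def power2_eq_square)
      also have "\<dots> \<le> (u (Suc (Suc k)) * x) * u (Suc (Suc (Suc k)))"
        using Suc power_sums_nonneg[OF f] by (intro mult_right_mono) (auto simp: u_def)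
      finally have "u (Suc (Suc k)) \<le> x * u (Suc (Suc (Suc k)))"
        using p by (simp add: mult.assoc)
      then show ?case using p by (simp add: mult.commute)
    qed
    have "u 1 * x \<le> u (Suc k) * x ^ Suc k" for k
    proof (induction k)
      case (Suc k)
      have "u (Suc k) * x ^ Suc k \<le> (u (Suc (Suc k)) * x) * x ^ Suc k"
        using step[of k] x by (intro mult_right_mono) auto
      also have "\<dots> = u (Suc (Suc k)) * x ^ Suc (Suc k)" by (simp only: power_Suc mult_ac)
      finally show ?case using Suc.IH by linarith
    qed simp
    then have "\<exists>N. \<forall>k\<ge>N. u 1 * x \<le> u (Suc k) * x ^ Suc k" by blast
    then have "u 1 * x \<le> 0" by (rule LIMSEQ_le_const[OF lim])
    then show False using mult_pos_pos[OF u1 x] by linarith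
  qed
qed

end

section \<open>The radius of convexity in terms of the first coefficients\<close>

lemma fps_conv_radius_infinityI:
  fixes b :: "nat \<Rightarrow> complex"
  assumes "\<And>w. summable (\<lambda>m. b m * w ^ m)"
  shows "fps_conv_radius (Abs_fps b) = \<infinity>"
proof -
  have "conv_radius b \<ge> \<infinity>" by (rule conv_radius_geI_ex') (rule assms)
  then show ?thesis by (simp add: fps_conv_radius_def)
qed

text \<open>With \<open>w = z ^ k\<close> the expression \<open>1 + z g'' / g'\<close> becomes
  \<open>1 + k w Q' / Q\<close>, so the quotient lemmas apply with \<open>l = k\<close> and radii
  turn into \<open>k\<close>-th roots. The first two power sums are \<open>- f 1\<close> and
  \<open>(f 1)\<^sup>2 - 2 * f 2\<close>.\<close>

lemma radius_of_convexity_bounds: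
  fixes q :: "nat \<Rightarrow> real" and k :: nat and g :: "complex \<Rightarrow> complex"
  assumes q: "positive_root_limit q" and k: "k > 0"
    and entire: "fps_conv_radius (fps_complex (Abs_fps q)) = \<infinity>"
    and g': "\<And>z. deriv g z = eval_fps (fps_complex (Abs_fps q)) (z ^ k)"
    and alt: "\<And>m. q m * q (Suc m) < 0"
  defines "f \<equiv> \<lambda>m. (1 + real k * real m) * q m"
  assumes f12: "2 * f 2 < (f 1)\<^sup>2" and f2: "f 2 > 0"
  shows "ereal (root k (1 / (- f 1))) < radius_of_convexity g"
    and "radius_of_convexity g < ereal (root k (- f 1 / ((f 1)\<^sup>2 - 2 * f 2)))"
proof -
  define u where "u = fps_nth (neg_log_deriv f)"
  have f: "positive_root_limit f" unfolding f_def using positive_root_limit_theta[OF q] k by simp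
  have f0: "f 0 = 1" by (rule positive_root_limit_0[OF f])
  have altf: "f m * f (Suc m) < 0" for m
  proof -
    have "f m * f (Suc m) = ((1 + real k * real m) * (1 + real k * real (Suc m))) * (q m * q (Suc m))"
      by (simp add: f_def)
    moreover have "(1 + real k * real m) * (1 + real k * real (Suc m)) > 0"
      by (intro mult_pos_pos add_pos_nonneg) simp_all
    ultimately show ?thesis using alt[of m] by (simp add: mult_pos_neg)
  qed
  have u0: "u 0 = - f 1" and u1_eq: "u 1 = (f 1)\<^sup>2 - 2 * f 2"
    unfolding u_def by (rule neg_log_deriv_0_1[of f, OF f0])+
  have u0_pos: "u 0 > 0" using altf[of 0] f0 by (simp add: u0)
  have u1: "u 1 > 0" using f12 unfolding u1_eq by simp
  have u_strict: "(u 1)\<^sup>2 < u 0 * u 2"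
    unfolding u_def by (rule power_sums_strict[OF f altf]) (use u1 in \<open>simp add: u_def\<close>)
  have "0 < u 0 * u 2" using u_strict zero_le_power2[of "u 1"] by linarith
  then have u2: "u 2 > 0" using u0_pos by (rule zero_less_mult_pos)
  define Q where "Q = fps_complex (Abs_fps q)"
  have convexity: "z * (deriv ^^ 2) g z / deriv g z
      = of_real (real k) * z ^ k * eval_fps (fps_deriv Q) (z ^ k) / eval_fps Q (z ^ k)" for z
  proof -
    have "((\<lambda>z. eval_fps Q (z ^ k)) has_field_derivative
        eval_fps (fps_deriv Q) (z ^ k) * (of_nat k * z ^ (k - 1))) (at z)"
      by (rule DERIV_chain2[OF has_field_derivative_eval_fps])
         (use entire in \<open>auto simp: Q_def intro!: derivative_eq_intros\<close>)
    moreover have "deriv g = (\<lambda>z. eval_fps Q (z ^ k))" using g' by (auto simp: Q_def)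
    ultimately have "(deriv ^^ 2) g z = eval_fps (fps_deriv Q) (z ^ k) * (of_nat k * z ^ (k - 1))"
      by (simp add: numeral_2_eq_2 DERIV_imp_deriv)
    moreover have "z * z ^ (k - 1) = z ^ k" using k by (simp add: power_eq_if)
    ultimately show ?thesis by (simp add: g' Q_def mult_ac)
  qed
  note quot = starlike_quotient_pos[OF q _ entire] starlike_quotient_radius_le[OF q _ entire]
  have k': "real k > 0" using k by simp
  have fu: "fps_nth (neg_log_deriv (\<lambda>m. (1 + real k * real m) * q m)) = u" by (simp add: u_def f_def)
  define \<rho> where "\<rho> = 1 / sqrt (u 1)"
  have good: "deriv g z \<noteq> 0 \<and> Re (1 + z * (deriv ^^ 2) g z / deriv g z) > 0"
    if "norm z < root k \<rho>" for z
  proof -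
    have "norm (z ^ k) < root k \<rho> ^ k"
      unfolding norm_power using that k by (intro power_strict_mono) auto
    also have "\<dots> = \<rho>" using k u1 by (intro real_root_pow_pos2) (simp_all add: \<rho>_def)
    finally have "norm (z ^ k) < \<rho>" .
    then show ?thesis
      using quot(1,2)[OF k', of "z ^ k"] u1 unfolding fu convexity by (simp add: \<rho>_def g' Q_def)
  qed
  have "\<rho> > 0" using u1 by (simp add: \<rho>_def)
  then have "ereal (root k \<rho>) \<le> radius_of_convexity g"
    unfolding radius_of_convexity_def using good k by (intro Sup_upper imageI) auto
  \<comment> \<open>Strictness of the lower bound:
    \<open>(u 0)\<^sup>2 - u 1 = 2 * f 2 > 0\<close>.\<close>
  moreover have "1 / u 0 < \<rho>"
  proof -
    have "u 1 < (u 0)\<^sup>2" using f2 unfolding u0 u1_eq by simp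
    then have "sqrt (u 1) < u 0" using u0_pos by (intro real_less_lsqrt) auto
    then show ?thesis using u0_pos u1 by (simp add: \<rho>_def divide_strict_left_mono)
  qed
  then have "ereal (root k (1 / (- f 1))) < ereal (root k \<rho>)" using k by (simp add: u0)
  ultimately show "ereal (root k (1 / (- f 1))) < radius_of_convexity g" by (rule less_le_trans[rotated])

  have "radius_of_convexity g \<le> ereal (root k (u 1 / u 2))"
    unfolding radius_of_convexity_def
  proof (rule Sup_least)
    fix R
    assume "R \<in> ereal ` {r. r > 0 \<and> (\<forall>z\<in>ball 0 r.
      deriv g z \<noteq> 0 \<and> Re (1 + z * (deriv ^^ 2) g z / deriv g z) > 0)}"
    then obtain r where R: "R = ereal r" and r: "0 < r"
      and good: "\<And>z. z \<in> ball 0 r \<Longrightarrow> deriv g z \<noteq> 0 \<and> Re (1 + z * (deriv ^^ 2) g z / deriv g z) > 0"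
      by blast
    \<comment> \<open>Every \<open>w\<close> with \<open>norm w < r ^ k\<close> is the
      \<open>k\<close>-th power of some \<open>z\<close> in the disc of radius \<open>r\<close>, so
      the condition on \<open>z\<close> covers the whole disc of \<open>w\<close>.\<close>
    have Qw: "eval_fps Q w \<noteq> 0 \<and> Re (1 + of_real (real k) * w * eval_fps (fps_deriv Q) w / eval_fps Q w) > 0"
      if w: "norm w < r ^ k" for w
    proof -
      have "k \<noteq> 0" using k by simp
      then obtain z where z: "w = z ^ k" by (rule exists_complex_root)
      have "norm z < r"
        by (rule power_less_imp_less_base[of _ k]) (use w r in \<open>simp_all add: z norm_power\<close>)
      then have "deriv g z \<noteq> 0 \<and> 0 < Re (1 + z * (deriv ^^ 2) g z / deriv g z)"
        by (intro good) simp
      then show ?thesis unfolding convexity z by (simp add: g' Q_def)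
    qed
    have "r ^ k \<le> u 1 / u 2"
      by (rule quot(3)[OF k', unfolded fu, folded Q_def, OF u1 u2]) (simp_all only: Qw simp_thms)
    then have "root k (r ^ k) \<le> root k (u 1 / u 2)" using k by simp
    then show "R \<le> ereal (root k (u 1 / u 2))" using k r by (simp add: R real_root_power_cancel)
  qed
  also have "u 1 / u 2 < u 0 / u 1"
    using u_strict u1 u2 by (simp add: field_simps power2_eq_square)
  then have "ereal (root k (u 1 / u 2)) < ereal (root k (u 0 / u 1))" using k by simp
  finally show "radius_of_convexity g < ereal (root k (- f 1 / ((f 1)\<^sup>2 - 2 * f 2)))"
    by (simp only: u0 u1_eq)
qed

section \<open>Derivatives of Bessel functions\<close>

context
  fixes n :: nat and \<nu> :: real
  assumes \<nu>: "\<nu> > real n - 1"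
begin

lemma bessel_coeff_eq_pochhammer:
  "bessel_coeff \<nu> n m = (-1) ^ m * pochhammer (\<nu> + 1) (2 * m)
     / (fact m * 4 ^ m * pochhammer (\<nu> - real n + 1) (2 * m) * pochhammer (\<nu> + 1) m)"
proof -
  have G: "Gamma (x + real j) = pochhammer x j * Gamma x" if "x > 0" for x :: real and j
  proof -
    have "x \<notin> \<int>\<^sub>\<le>\<^sub>0" using that by (auto simp: nonpos_Ints_def)
    then show ?thesis using pochhammer_Gamma[of x j] Gamma_real_pos[OF that] by simp
  qed
  have pos: "\<nu> + 1 > 0" "\<nu> - real n + 1 > 0" using \<nu> by linarith+
  have "2 * real m + \<nu> + 1 = (\<nu> + 1) + real (2 * m)"
    "2 * real m - real n + \<nu> + 1 = (\<nu> - real n + 1) + real (2 * m)"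
    "real m + \<nu> + 1 = (\<nu> + 1) + real m" by simp_all
  then show ?thesis
    unfolding bessel_coeff_def using Gamma_real_pos[OF pos(1)] Gamma_real_pos[OF pos(2)]
    by (simp only: G[OF pos(1)] G[OF pos(2)]) (simp add: mult_ac)
qed

lemma bessel_coeff_alternating: "bessel_coeff \<nu> n m * bessel_coeff \<nu> n (Suc m) < 0"
proof -
  define p where "p m = pochhammer (\<nu> + 1) (2 * m)
     / (fact m * 4 ^ m * pochhammer (\<nu> - real n + 1) (2 * m) * pochhammer (\<nu> + 1) m)" for m
  have "\<nu> + 1 > 0" "\<nu> - real n + 1 > 0" using \<nu> by linarith+
  then have p: "p m > 0" for m by (simp add: p_def pochhammer_pos)
  have "bessel_coeff \<nu> n m = (-1) ^ m * p m" for m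
    by (simp add: bessel_coeff_eq_pochhammer p_def)
  then have "bessel_coeff \<nu> n m * bessel_coeff \<nu> n (Suc m) = - (p m * p (Suc m))"
    by (simp flip: power_add mult_2)
  then show ?thesis using p[of m] p[of "Suc m"] by simp
qed

lemma bessel_coeff_1:
  "bessel_coeff \<nu> n 1 = - ((\<nu> + 2) / (4 * ((\<nu> - real n + 2) * (\<nu> - real n + 1))))"
proof -
  have "\<nu> + 1 > 0" using \<nu> by linarith
  then show ?thesis
    by (simp add: bessel_coeff_eq_pochhammer eval_nat_numeral pochhammer_Suc) (simp add: algebra_simps)
qed

lemma bessel_coeff_2:
  "bessel_coeff \<nu> n 2 = (\<nu> + 4) * (\<nu> + 3) /
     (32 * ((\<nu> - real n + 4) * (\<nu> - real n + 3) * (\<nu> - real n + 2) * (\<nu> - real n + 1)))"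
proof -
  have "\<nu> + 1 > 0" using \<nu> by linarith
  then show ?thesis
    by (simp add: bessel_coeff_eq_pochhammer eval_nat_numeral pochhammer_Suc) (simp add: algebra_simps)
qed

text \<open>Both factorwise comparisons reduce to \<open>b \<le> \<nu> + 1\<close>, that is
  \<open>n \<ge> 0\<close>; strictness comes from replacing \<open>\<nu> + 1\<close> by
  \<open>\<nu> + 2\<close>. The result makes the second power sum positive.\<close>

lemma bessel_coeff_1_2: "2 * bessel_coeff \<nu> n 2 < (bessel_coeff \<nu> n 1)\<^sup>2"
proof -
  define b where "b = \<nu> - real n + 1"
  have b: "0 < b" "b \<le> \<nu> + 1" using \<nu> by (simp_all add: b_def)
  have "(b + 1) * (\<nu> + 4) \<le> (\<nu> + 2) * (b + 3)" "b * (\<nu> + 3) \<le> (\<nu> + 1) * (b + 2)"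
    using b by (simp_all add: algebra_simps)
  then have "((b + 1) * (\<nu> + 4)) * (b * (\<nu> + 3)) \<le> ((\<nu> + 2) * (b + 3)) * ((\<nu> + 1) * (b + 2))"
    by (rule mult_mono) (use b in \<open>auto intro!: mult_nonneg_nonneg\<close>)
  also have "\<dots> < ((\<nu> + 2) * (b + 3)) * ((\<nu> + 2) * (b + 2))"
    using b by (intro mult_strict_left_mono mult_strict_right_mono mult_pos_pos) auto
  finally have key: "((b + 1) * (\<nu> + 4)) * (b * (\<nu> + 3)) < ((\<nu> + 2) * (b + 3)) * ((\<nu> + 2) * (b + 2))" .
  have eqs: "\<nu> - real n + 1 = b" "\<nu> - real n + 2 = b + 1" "\<nu> - real n + 3 = b + 2" "\<nu> - real n + 4 = b + 3"
    by (simp_all add: b_def)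
  have frac: "2 * (x * y / (32 * (r * s * p * q))) = (p * x) * (q * y) / (16 * (p * q)\<^sup>2 * (r * s))"
    if "p > 0" "q > 0" "r > 0" "s > 0" for p q r s x y :: real
    using that by (simp add: field_simps power2_eq_square)
  have "2 * bessel_coeff \<nu> n 2 = ((b + 1) * (\<nu> + 4)) * (b * (\<nu> + 3)) / (16 * ((b + 1) * b)\<^sup>2 * ((b + 3) * (b + 2)))"
    unfolding bessel_coeff_2 eqs by (rule frac) (use b in auto)
  also have "\<dots> < ((\<nu> + 2) * (b + 3)) * ((\<nu> + 2) * (b + 2)) / (16 * ((b + 1) * b)\<^sup>2 * ((b + 3) * (b + 2)))"
    using b key by (intro divide_strict_right_mono mult_pos_pos zero_less_power) auto
  also have "\<dots> = (bessel_coeff \<nu> n 1)\<^sup>2"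
    using b unfolding bessel_coeff_1 eqs by (simp add: power_divide power_mult_distrib) (simp add: power2_eq_square)
  finally show ?thesis .
qed

section \<open>The derivatives of \<open>bessel_g\<close> and \<open>bessel_h\<close>, and the
  explicit constants\<close>

lemma eval_bessel_theta:
  defines "P \<equiv> \<lambda>w. \<Sum>m. complex_of_real (bessel_coeff \<nu> n m) * w ^ m"
  defines "D \<equiv> \<lambda>w. \<Sum>m. diffs (\<lambda>m. complex_of_real (bessel_coeff \<nu> n m)) m * w ^ m"
  defines "Q \<equiv> \<lambda>l. fps_complex (Abs_fps (\<lambda>m. (1 + l * real m) * bessel_coeff \<nu> n m))"
  assumes l: "l \<noteq> 0"
  shows "(P has_field_derivative D w) (at w)"
    and "fps_conv_radius (Q l) = \<infinity>"
    and "eval_fps (Q l) w = P w + of_real l * w * D w"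
proof -
  note S = deriv_coeffs_summable[OF bessel_coeff_summable[OF \<nu>]]
  show "(P has_field_derivative D w) (at w)" unfolding P_def D_def by (rule S(2))
  \<comment> \<open>Factoring out \<open>l / 2\<close> brings the terms to the form
    \<open>2 m + c\<close> with \<open>c = 2 / l\<close>, for which summability and the sum are
    known.\<close>
  have eq: "complex_of_real ((1 + l * real m) * bessel_coeff \<nu> n m) * w ^ m
      = of_real (l / 2) * ((2 * of_nat m + of_real (2 / l)) * complex_of_real (bessel_coeff \<nu> n m) * w ^ m)" for m w
    using l by (simp add: field_simps)
  have sm: "summable (\<lambda>m. complex_of_real ((1 + l * real m) * bessel_coeff \<nu> n m) * w ^ m)" for w
    unfolding eq by (intro summable_mult S(1))
  then show "fps_conv_radius (Q l) = \<infinity>"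
    unfolding Q_def fps_complex_def fps_nth_Abs_fps by (rule fps_conv_radius_infinityI)
  have "eval_fps (Q l) w = (\<Sum>m. of_real (l / 2) *
      ((2 * of_nat m + of_real (2 / l)) * complex_of_real (bessel_coeff \<nu> n m) * w ^ m))"
    unfolding eq[symmetric] by (simp add: eval_fps_def Q_def)
  also have "\<dots> = of_real (l / 2) * (2 * w * D w + of_real (2 / l) * P w)"
    unfolding P_def D_def by (subst suminf_mult[OF S(1)]) (simp only: S(3))
  also have "\<dots> = P w + of_real l * w * D w"
    using l by (simp add: field_simps)
  finally show "eval_fps (Q l) w = P w + of_real l * w * D w" .
qed

lemma deriv_bessel_g:
  "deriv (bessel_g \<nu> n) z =
     eval_fps (fps_complex (Abs_fps (\<lambda>m. (1 + 2 * real m) * bessel_coeff \<nu> n m))) (z ^ 2)"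
proof -
  define P where "P w = (\<Sum>m. complex_of_real (bessel_coeff \<nu> n m) * w ^ m)" for w
  define D where "D w = (\<Sum>m. diffs (\<lambda>m. complex_of_real (bessel_coeff \<nu> n m)) m * w ^ m)" for w
  note E = eval_bessel_theta[of 2, folded P_def D_def]
  have "bessel_g \<nu> n z = z * P (z ^ 2)" for z
  proof -
    have "(\<lambda>m. z * (of_real (bessel_coeff \<nu> n m) * (z ^ 2) ^ m)) sums (z * P (z ^ 2))"
      unfolding P_def by (intro sums_mult summable_sums bessel_coeff_summable[OF \<nu>])
    moreover have "z * (of_real (bessel_coeff \<nu> n m) * (z ^ 2) ^ m) = of_real (bessel_coeff \<nu> n m) * z ^ (2 * m + 1)" for m
      by (simp add: power_mult)
    ultimately show ?thesis using bessel_g_sums[OF \<nu>, of z] by (metis (no_types, lifting) sums_cong sums_unique2)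
  qed
  then have g: "bessel_g \<nu> n = (\<lambda>z. z * P (z ^ 2))" by blast
  have "((\<lambda>z. z * P (z ^ 2)) has_field_derivative 1 * P (z ^ 2) + (D (z ^ 2) * (2 * z)) * z) (at z)"
    by (intro DERIV_mult DERIV_ident DERIV_chain2[where f = P] E)
       (auto intro!: derivative_eq_intros)
  then have "deriv (bessel_g \<nu> n) z = 1 * P (z ^ 2) + (D (z ^ 2) * (2 * z)) * z"
    unfolding g by (rule DERIV_imp_deriv)
  also have "\<dots> = P (z ^ 2) + of_real 2 * z ^ 2 * D (z ^ 2)" by (simp add: power2_eq_square)
  also have "\<dots> = eval_fps (fps_complex (Abs_fps (\<lambda>m. (1 + 2 * real m) * bessel_coeff \<nu> n m))) (z ^ 2)"
    by (rule E(3)[symmetric]) simp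
  finally show ?thesis .
qed

lemma deriv_bessel_h:
  "deriv (bessel_h \<nu> n) z =
     eval_fps (fps_complex (Abs_fps (\<lambda>m. (1 + 1 * real m) * bessel_coeff \<nu> n m))) (z ^ 1)"
proof -
  define P where "P w = (\<Sum>m. complex_of_real (bessel_coeff \<nu> n m) * w ^ m)" for w
  define D where "D w = (\<Sum>m. diffs (\<lambda>m. complex_of_real (bessel_coeff \<nu> n m)) m * w ^ m)" for w
  note E = eval_bessel_theta[of 1, folded P_def D_def]
  have "bessel_h \<nu> n z = z * P z" for z
  proof -
    have "(\<lambda>m. z * (of_real (bessel_coeff \<nu> n m) * z ^ m)) sums (z * P z)"
      unfolding P_def by (intro sums_mult summable_sums bessel_coeff_summable[OF \<nu>])
    moreover have "z * (of_real (bessel_coeff \<nu> n m) * z ^ m) = of_real (bessel_coeff \<nu> n m) * z ^ (m + 1)" for m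
      by simp
    ultimately show ?thesis using bessel_h_sums[OF \<nu>, of z] by (metis (no_types, lifting) sums_cong sums_unique2)
  qed
  then have "bessel_h \<nu> n = (\<lambda>z. z * P z)" by blast
  moreover have "((\<lambda>z. z * P z) has_field_derivative 1 * P z + D z * z) (at z)"
    by (intro DERIV_mult DERIV_ident E) simp
  ultimately show ?thesis using E(3)[of z] by (simp add: DERIV_imp_deriv mult_ac)
qed

text \<open>\<open>f\<close> carries the factor \<open>1 + k m\<close> twice, whence the squares in
  \<open>A\<close> and \<open>B\<close>. The first power sum is \<open>A * X\<close>;
  \<open>B\<close> is chosen so that \<open>2 * f 2 = (A * X) * (B * Y)\<close>. The second power
  sum is then \<open>(A * X) * (A * X - B * Y)\<close>, and \<open>A * X\<close> cancels in the
  upper bound.\<close>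

lemma radius_of_convexity_bessel:
  fixes k :: nat
  assumes k: "k > 0" and g': "\<And>z. deriv g z =
     eval_fps (fps_complex (Abs_fps (\<lambda>m. (1 + real k * real m) * bessel_coeff \<nu> n m))) (z ^ k)"
  defines "A \<equiv> (1 + real k)\<^sup>2 / 4" and "B \<equiv> (1 + 2 * real k)\<^sup>2 / (4 * (1 + real k)\<^sup>2)"
  defines "X \<equiv> (\<nu> + 2) / ((\<nu> - real n + 2) * (\<nu> - real n + 1))"
    and "Y \<equiv> (\<nu> + 4) * (\<nu> + 3) / ((\<nu> - real n + 4) * (\<nu> - real n + 3) * (\<nu> + 2))"
  shows "ereal (root k (1 / (A * X))) < radius_of_convexity g"
    and "radius_of_convexity g < ereal (root k (1 / (A * X - B * Y)))"
proof -
  define q where "q m = (1 + real k * real m) * bessel_coeff \<nu> n m" for m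
  define f where "f m = (1 + real k * real m) * q m" for m
  have pos: "\<nu> - real n + 1 > 0" "\<nu> + 1 > 0" using \<nu> by linarith+
  have q: "positive_root_limit q"
    unfolding q_def [abs_def] using k by (intro positive_root_limit_theta positive_root_limit_bessel_coeff \<nu>) simp
  have entire: "fps_conv_radius (fps_complex (Abs_fps q)) = \<infinity>"
    unfolding q_def [abs_def] using k by (intro eval_bessel_theta) simp
  have alt: "q m * q (Suc m) < 0" for m
  proof -
    have "q m * q (Suc m) = ((1 + real k * real m) * (1 + real k * real (Suc m))) * (bessel_coeff \<nu> n m * bessel_coeff \<nu> n (Suc m))"
      by (simp add: q_def)
    moreover have "(1 + real k * real m) * (1 + real k * real (Suc m)) > 0"
      by (intro mult_pos_pos add_pos_nonneg) simp_all
    ultimately show ?thesis using bessel_coeff_alternating[of m] by (simp add: mult_pos_neg)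
  qed
  have f1: "f 1 = (1 + real k)\<^sup>2 * bessel_coeff \<nu> n 1" and f2: "f 2 = (1 + 2 * real k)\<^sup>2 * bessel_coeff \<nu> n 2"
    by (simp_all add: f_def q_def power2_eq_square mult_ac)
  have a2: "bessel_coeff \<nu> n 2 > 0" using pos by (simp add: bessel_coeff_2)
  then have f2_pos: "f 2 > 0" unfolding f2 using k by (intro mult_pos_pos) auto
  \<comment> \<open>Since \<open>1 + 2 k \<le> (1 + k)\<^sup>2\<close>, the inequality for the
    Bessel coefficients carries over to \<open>f\<close>.\<close>
  have "(1 + 2 * real k)\<^sup>2 \<le> ((1 + real k)\<^sup>2)\<^sup>2"
    by (intro power_mono) (simp_all add: power2_eq_square algebra_simps)
  then have "2 * f 2 \<le> ((1 + real k)\<^sup>2)\<^sup>2 * (2 * bessel_coeff \<nu> n 2)"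
    using a2 by (simp add: f2)
  also have "\<dots> < ((1 + real k)\<^sup>2)\<^sup>2 * (bessel_coeff \<nu> n 1)\<^sup>2"
    using k by (intro mult_strict_left_mono bessel_coeff_1_2) auto
  also have "\<dots> = (f 1)\<^sup>2" unfolding f1 power_mult_distrib ..
  finally have f12: "2 * f 2 < (f 1)\<^sup>2" .
  have AX: "- f 1 = A * X"
    unfolding f1 bessel_coeff_1 A_def X_def by simp
  have AX_pos: "A * X > 0" unfolding A_def X_def using pos k by (intro mult_pos_pos divide_pos_pos) auto
  have "2 * f 2 = (A * X) * (B * Y)"
  proof -
    have "A * B = (1 + 2 * real k)\<^sup>2 / 16" unfolding A_def B_def using k by simp
    moreover have "X * Y = 32 * bessel_coeff \<nu> n 2" using pos by (simp add: X_def Y_def bessel_coeff_2)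
    moreover have "(A * X) * (B * Y) = (A * B) * (X * Y)" by (simp only: mult_ac)
    ultimately have "(A * X) * (B * Y) = (1 + 2 * real k)\<^sup>2 / 16 * (32 * bessel_coeff \<nu> n 2)"
      by metis
    then show ?thesis by (simp add: f2)
  qed
  then have D: "(f 1)\<^sup>2 - 2 * f 2 = (A * X) * (A * X - B * Y)"
    using AX by (simp add: right_diff_distrib) (metis power2_eq_square power2_minus)
  have upper: "- f 1 / ((f 1)\<^sup>2 - 2 * f 2) = 1 / (A * X - B * Y)"
    unfolding AX D by (rule nonzero_divide_mult_cancel_left) (use AX_pos in linarith)
  note bounds = radius_of_convexity_bounds[OF q k entire _ alt, folded f_def, OF _ f12 f2_pos, of g]
  show "ereal (root k (1 / (A * X))) < radius_of_convexity g"
    using bounds(1) g' unfolding AX by (simp add: q_def [abs_def])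
  show "radius_of_convexity g < ereal (root k (1 / (A * X - B * Y)))"
    using bounds(2) g' unfolding upper by (simp add: q_def [abs_def])
qed

end

theorem theorem3p4:
  fixes n :: nat and \<nu> :: real
  assumes "\<nu> > real n - 1"
  shows
    "(ereal (2 / 3 * sqrt ((\<nu> - real n + 2) * (\<nu> - real n + 1) / (\<nu> + 2)))
        < radius_of_convexity (bessel_g \<nu> n)
      \<and> radius_of_convexity (bessel_g \<nu> n)
        < ereal (2 * sqrt (1 /
            (9 * (\<nu> + 2) / ((\<nu> - real n + 2) * (\<nu> - real n + 1))
             - 25 * (\<nu> + 4) * (\<nu> + 3)
               / (9 * (\<nu> - real n + 4) * (\<nu> - real n + 3) * (\<nu> + 2))))))
     \<and>
     (ereal ((\<nu> - real n + 2) * (\<nu> - real n + 1) / (\<nu> + 2))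
        < radius_of_convexity (bessel_h \<nu> n)
      \<and> radius_of_convexity (bessel_h \<nu> n)
        < ereal (1 /
            ((\<nu> + 2) / ((\<nu> - real n + 2) * (\<nu> - real n + 1))
             - 9 * (\<nu> + 4) * (\<nu> + 3)
               / (16 * (\<nu> - real n + 4) * (\<nu> - real n + 3) * (\<nu> + 2)))))"
proof -
  define X where "X = (\<nu> + 2) / ((\<nu> - real n + 2) * (\<nu> - real n + 1))"
  define Y where "Y = (\<nu> + 4) * (\<nu> + 3) / ((\<nu> - real n + 4) * (\<nu> - real n + 3) * (\<nu> + 2))"
  \<comment> \<open>\<open>k = 2\<close> gives \<open>A = 9 / 4\<close> and
    \<open>B = 25 / 36\<close>, where the square root releases a factor 2; \<open>k = 1\<close>
    gives \<open>A = 1\<close> and \<open>B = 9 / 16\<close>.\<close>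
  note g = radius_of_convexity_bessel[OF assms, of 2 "bessel_g \<nu> n", folded X_def Y_def]
  note h = radius_of_convexity_bessel[OF assms, of 1 "bessel_h \<nu> n", folded X_def Y_def]
  have g1: "root 2 (1 / ((1 + real 2)\<^sup>2 / 4 * X)) = 2 / 3 * sqrt (1 / X)"
  proof -
    have "1 / ((1 + real 2)\<^sup>2 / 4 * X) = (2 / 3)\<^sup>2 * (1 / X)" by (simp add: power2_eq_square)
    then show ?thesis unfolding sqrt_def[symmetric] by (simp only: real_sqrt_mult) simp
  qed
  have g2: "root 2 (1 / ((1 + real 2)\<^sup>2 / 4 * X - (1 + 2 * real 2)\<^sup>2 / (4 * (1 + real 2)\<^sup>2) * Y))
      = 2 * sqrt (1 / (9 * X - 25 / 9 * Y))"
  proof -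
    have "(1 + real 2)\<^sup>2 / 4 * X - (1 + 2 * real 2)\<^sup>2 / (4 * (1 + real 2)\<^sup>2) * Y = (9 * X - 25 / 9 * Y) / 2\<^sup>2"
      by (simp add: power2_eq_square diff_divide_distrib)
    moreover have "1 / (w / 2\<^sup>2) = 2\<^sup>2 * (1 / w)" for w :: real by simp
    ultimately have "1 / ((1 + real 2)\<^sup>2 / 4 * X - (1 + 2 * real 2)\<^sup>2 / (4 * (1 + real 2)\<^sup>2) * Y)
        = 2\<^sup>2 * (1 / (9 * X - 25 / 9 * Y))" by (simp only:)
    then show ?thesis unfolding sqrt_def[symmetric] by (simp only: real_sqrt_mult) simp
  qed
  have G: "ereal (2 / 3 * sqrt (1 / X)) < radius_of_convexity (bessel_g \<nu> n)"
    "radius_of_convexity (bessel_g \<nu> n) < ereal (2 * sqrt (1 / (9 * X - 25 / 9 * Y)))"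
    using g deriv_bessel_g[OF assms] unfolding g1 g2 by simp_all
  have H: "ereal (1 / X) < radius_of_convexity (bessel_h \<nu> n)"
    "radius_of_convexity (bessel_h \<nu> n) < ereal (1 / (X - 9 / 16 * Y))"
    using h deriv_bessel_h[OF assms] by (simp_all add: power2_eq_square)
  have "1 / X = (\<nu> - real n + 2) * (\<nu> - real n + 1) / (\<nu> + 2)" by (simp add: X_def)
  moreover have "9 * X - 25 / 9 * Y = 9 * (\<nu> + 2) / ((\<nu> - real n + 2) * (\<nu> - real n + 1))
      - 25 * (\<nu> + 4) * (\<nu> + 3) / (9 * (\<nu> - real n + 4) * (\<nu> - real n + 3) * (\<nu> + 2))"
    unfolding X_def Y_def times_divide_times_eq by (simp only: times_divide_eq_right mult.assoc)
  moreover have "X - 9 / 16 * Y = (\<nu> + 2) / ((\<nu> - real n + 2) * (\<nu> - real n + 1))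
      - 9 * (\<nu> + 4) * (\<nu> + 3) / (16 * (\<nu> - real n + 4) * (\<nu> - real n + 3) * (\<nu> + 2))"
    unfolding X_def Y_def times_divide_times_eq by (simp only: times_divide_eq_right mult.assoc)
  ultimately show ?thesis using G H by simp
qed

end
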